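(* Let $\mathcal L$ be a constant-coefficient linear scalar partial differential operator of order $c$ in $d$ dimensions and let $\boldsymbol c_1,\boldsymbol c_2\in\mathbb R^d$. Translating a local expansion of order $p$ in compressed representation around center $\boldsymbol c_1$ to a local expansion of order $p$ in compressed representation around center $\boldsymbol c_2$ (the problem defined in the context) can be achieved with $O(p^d)$ work as $p\to\infty$.
   Context: Notation. $d\ge1$; for $\boldsymbol q\in\mathbb N_0^d$, $|\boldsymbol q|=\sum_i q_i$, $\boldsymbol q!=\prod_i q_i!$, $\boldsymbol x^{\boldsymbol q}=\prod_i x_i^{q_i}$, $\binom{\boldsymbol q}{\boldsymbol r}=\prod_i\binom{q_i}{r_i}$, and $\boldsymbol m\ge\boldsymbol n$ is meant componentwise. $\mathcal M(p)=\{\boldsymbol q\in\mathbb N_0^d:|\boldsymbol q|\le p\}$, $N(p)=|\mathcal M(p)|$. $\mathcal L=\sum_{\boldsymbol m\in\mathcal M(c)}a_{\boldsymbol m}\partial^{\boldsymbol m}$, $a_{\boldsymbol m}\in\mathbb C$, has order $c\ge1$ ($a_{\boldsymbol m}\ne0$ for some $|\boldsymbol m|=c$), and $p\ge c$. Graded monomial ordering: a bijection $\boldsymbol\nu:\mathbb N=\{1,2,\dots\}\to\mathbb N_0^d$ with $\boldsymbol\nu(1)=\boldsymbol 0$; $|\boldsymbol\nu(i)|<|\boldsymbol\nu(j)|\Rightarrow i<j$; and $i<j\Rightarrow\boldsymbol\nu^{-1}(\boldsymbol\nu(i)+\boldsymbol\nu(k))<\boldsymbol\nu^{-1}(\boldsymbol\nu(j)+\boldsymbol\nu(k))$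 for all $i,j,k$. Fix one. Compression. Let $P\in\mathbb C^{N(p-c)\times N(p)}$, $P_{i_1,i_2}=b_{\boldsymbol\nu(i_1),\boldsymbol\nu(i_2)}$, where $b_{\boldsymbol n,\boldsymbol m}=a_{\boldsymbol m-\boldsymbol n}$ if $\boldsymbol m\ge\boldsymbol n$ and $\boldsymbol m-\boldsymbol n\in\mathcal M(c)$, and $0$ otherwise. Let $h(i)$ be the index of the last nonzero column in row $i$ of $P$, $\bar{\boldsymbol j}=\{h(1),\dots,h(N(p-c))\}$ and $\boldsymbol j=\{1,\dots,N(p)\}\setminus\bar{\boldsymbol j}$. The submatrix $P_{[:,\bar{\boldsymbol j}]}$ of the columns $\bar{\boldsymbol j}$ is square and invertible. The decompression matrix $M$, with $N(p)$ rows and columns indexed by $\boldsymbol j$, has $M_{[\boldsymbol j,:]}=I$ and $M_{[\bar{\boldsymbol j},:]}=-P_{[:,\bar{\boldsymbol j}]}^{-1}P_{[:,\boldsymbol j]}$. A local expansion of order $p$ around $\boldsymbol c_1$ is stored in compressed representation as a vector $\boldsymbol\theta=(\boldsymbol\theta_i)_{i\in\boldsymbol j}$ (the derivatives of the potential at $\boldsymbol c_1$ with multi-indices $\boldsymbol\nu(i)$, $i\in\boldsymbol j$); its full Taylor coefficients are $\boldsymbol\gamma_q=[M\boldsymbol\theta]_q/\boldsymbol\nu(q)!$, $1\le q\le N(p)$, and it represents $\boldsymbol x\mapsto\sum_{q=1}^{N(p)}\boldsymbol\gamma_q(\boldsymbol x-\boldsymbol c_1)^{\boldsymbol\nu(q)}$.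 Translation problem (local-to-local): given $\boldsymbol\theta$ around $\boldsymbol c_1$, compute, for all $i\in\boldsymbol j$, the compressed-representation coefficients around $\boldsymbol c_2$, $$\boldsymbol\mu_i=\sum_{q\in\{1,\dots,N(p)\},\ \boldsymbol\nu(q)\ge\boldsymbol\nu(i)}\boldsymbol\gamma_q\binom{\boldsymbol\nu(q)}{\boldsymbol\nu(i)}(\boldsymbol c_2-\boldsymbol c_1)^{\boldsymbol\nu(q)-\boldsymbol\nu(i)} .$$ (Equivalently the derivatives $\boldsymbol\nu(i)!\,\boldsymbol\mu_i$.) Work is the number of scalar arithmetic operations in $\mathbb C$. Implied constants may depend on $d$, $\mathcal L$ and $\boldsymbol\nu$ but not on $p$. *)

theory Defs
  imports "HOL-Analysis.Analysis" "HOL-Library.Landau_Symbols"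
begin

text \<open>
  A multi-index is an element of \<open>nat ^ 'd\<close>, where \<open>CARD('d)\<close> is the dimension \<open>d\<close>. Addition,
  truncated subtraction, \<open>0\<close> and \<open>\<le>\<close> on this type are the componentwise library operations.
\<close>

definition mi_abs :: "nat ^ 'd \<Rightarrow> nat" where
  "mi_abs q = (\<Sum>k\<in>UNIV. q $ k)"

definition mi_fact :: "nat ^ 'd \<Rightarrow> nat" where
  "mi_fact q = (\<Prod>k\<in>UNIV. fact (q $ k))"

definition mi_binomial :: "nat ^ 'd \<Rightarrow> nat ^ 'd \<Rightarrow> nat" where
  "mi_binomial q r = (\<Prod>k\<in>UNIV. (q $ k) choose (r $ k))"

definition mi_power :: "real ^ 'd \<Rightarrow> nat ^ 'd \<Rightarrow> real" where
  "mi_power x q = (\<Prod>k\<in>UNIV. (x $ k) ^ (q $ k))"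

definition mi_upto :: "nat \<Rightarrow> (nat ^ 'd) set" where
  "mi_upto p = {q. mi_abs q \<le> p}"

definition num_mi :: "'d::finite itself \<Rightarrow> nat \<Rightarrow> nat" where
  "num_mi _ p = card (mi_upto p :: (nat ^ 'd) set)"

text \<open>
  An ordering enumerates the multi-indices by the positive integers; \<open>\<nu> 0\<close> is irrelevant.
\<close>

definition mi_index :: "(nat \<Rightarrow> nat ^ 'd) \<Rightarrow> nat ^ 'd \<Rightarrow> nat" where
  "mi_index \<nu> = inv_into {1..} \<nu>"

definition graded_monomial_ordering :: "(nat \<Rightarrow> nat ^ 'd) \<Rightarrow> bool" where
  "graded_monomial_ordering \<nu> \<longleftrightarrow>
     bij_betw \<nu> {1..} UNIV \<and>
     \<nu> 1 = 0 \<and>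
     (\<forall>i\<ge>1. \<forall>j\<ge>1. mi_abs (\<nu> i) < mi_abs (\<nu> j) \<longrightarrow> i < j) \<and>
     (\<forall>i\<ge>1. \<forall>j\<ge>1. \<forall>k\<ge>1. i < j \<longrightarrow> mi_index \<nu> (\<nu> i + \<nu> k) < mi_index \<nu> (\<nu> j + \<nu> k))"

text \<open>
  The operator \<open>\<L> = (\<Sum>m\<in>mi_upto c. a m \<partial>\<^sup>m)\<close> is given by its coefficient function \<open>a\<close>; values of \<open>a\<close>
  outside of \<open>mi_upto c\<close> are never used. Matrices are functions of a row and a column index, where
  the indices range over finite sets of positive integers.
\<close>

definition pde_matrix ::
    "(nat \<Rightarrow> nat ^ 'd) \<Rightarrow> (nat ^ 'd \<Rightarrow> complex) \<Rightarrow> nat \<Rightarrow> nat \<Rightarrow> nat \<Rightarrow> complex" where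
  "pde_matrix \<nu> a c i k =
     (if \<nu> i \<le> \<nu> k \<and> \<nu> k - \<nu> i \<in> mi_upto c then a (\<nu> k - \<nu> i) else 0)"

definition pde_rows :: "'d::finite itself \<Rightarrow> nat \<Rightarrow> nat \<Rightarrow> nat set" where
  "pde_rows T c p = {1..num_mi T (p - c)}"

definition pde_columns :: "'d::finite itself \<Rightarrow> nat \<Rightarrow> nat set" where
  "pde_columns T p = {1..num_mi T p}"

definition last_nonzero ::
    "(nat \<Rightarrow> nat ^ 'd) \<Rightarrow> (nat ^ 'd \<Rightarrow> complex) \<Rightarrow> nat \<Rightarrow> nat \<Rightarrow> nat \<Rightarrow> nat" where
  "last_nonzero \<nu> a c p i = Max {k \<in> pde_columns TYPE('d) p. pde_matrix \<nu> a c i k \<noteq> 0}"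

definition dropped ::
    "(nat \<Rightarrow> nat ^ 'd) \<Rightarrow> (nat ^ 'd \<Rightarrow> complex) \<Rightarrow> nat \<Rightarrow> nat \<Rightarrow> nat set" where
  "dropped \<nu> a c p = last_nonzero \<nu> a c p ` pde_rows TYPE('d) c p"

definition stored ::
    "(nat \<Rightarrow> nat ^ 'd) \<Rightarrow> (nat ^ 'd \<Rightarrow> complex) \<Rightarrow> nat \<Rightarrow> nat \<Rightarrow> nat set" where
  "stored \<nu> a c p = pde_columns TYPE('d) p - dropped \<nu> a c p"

definition matrix_inverse_on ::
    "nat set \<Rightarrow> nat set \<Rightarrow> (nat \<Rightarrow> nat \<Rightarrow> complex) \<Rightarrow> (nat \<Rightarrow> nat \<Rightarrow> complex) \<Rightarrow> bool" where
  "matrix_inverse_on R C A B \<longleftrightarrow>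
     (\<forall>i\<in>R. \<forall>i'\<in>R. (\<Sum>k\<in>C. A i k * B k i') = (if i = i' then 1 else 0)) \<and>
     (\<forall>k\<in>C. \<forall>k'\<in>C. (\<Sum>i\<in>R. B k i * A i k') = (if k = k' then 1 else 0))"

text \<open>
  For a graded monomial ordering, an operator of order \<open>c\<close> and \<open>p \<ge> c\<close>, the inverse exists: with
  the columns in the order in which \<open>last_nonzero\<close> lists them, the square matrix is triangular with
  a nonzero constant diagonal. The entries of the inverse with indices in \<open>dropped\<close> and \<open>pde_rows\<close>
  are uniquely determined, and no others are used below.
\<close>

definition dropped_inverse ::
    "(nat \<Rightarrow> nat ^ 'd) \<Rightarrow> (nat ^ 'd \<Rightarrow> complex) \<Rightarrow> nat \<Rightarrow> nat \<Rightarrow> nat \<Rightarrow> nat \<Rightarrow> complex" where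
  "dropped_inverse \<nu> a c p =
     (SOME B. matrix_inverse_on (pde_rows TYPE('d) c p) (dropped \<nu> a c p) (pde_matrix \<nu> a c) B)"

definition decompression_matrix ::
    "(nat \<Rightarrow> nat ^ 'd) \<Rightarrow> (nat ^ 'd \<Rightarrow> complex) \<Rightarrow> nat \<Rightarrow> nat \<Rightarrow> nat \<Rightarrow> nat \<Rightarrow> complex" where
  "decompression_matrix \<nu> a c p q k =
     (if q \<in> stored \<nu> a c p then (if q = k then 1 else 0)
      else - (\<Sum>i\<in>pde_rows TYPE('d) c p. dropped_inverse \<nu> a c p q i * pde_matrix \<nu> a c i k))"

definition taylor_coeff ::
    "(nat \<Rightarrow> nat ^ 'd) \<Rightarrow> (nat ^ 'd \<Rightarrow> complex) \<Rightarrow> nat \<Rightarrow> nat \<Rightarrow> (nat \<Rightarrow> complex) \<Rightarrow> nat \<Rightarrow> complex" where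
  "taylor_coeff \<nu> a c p \<theta> q =
     (\<Sum>k\<in>stored \<nu> a c p. decompression_matrix \<nu> a c p q k * \<theta> k) / of_nat (mi_fact (\<nu> q))"

definition translated_coeff ::
    "(nat \<Rightarrow> nat ^ 'd) \<Rightarrow> (nat ^ 'd \<Rightarrow> complex) \<Rightarrow> nat \<Rightarrow> nat \<Rightarrow> real ^ 'd \<Rightarrow> real ^ 'd \<Rightarrow>
      (nat \<Rightarrow> complex) \<Rightarrow> nat \<Rightarrow> complex" where
  "translated_coeff \<nu> a c p c1 c2 \<theta> i =
     (\<Sum>q | q \<in> {1..num_mi TYPE('d) p} \<and> \<nu> q \<ge> \<nu> i.
        taylor_coeff \<nu> a c p \<theta> q * of_nat (mi_binomial (\<nu> q) (\<nu> i)) *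
        of_real (mi_power (c2 - c1) (\<nu> q - \<nu> i)))"

text \<open>
  An algorithm of a given order is a straight-line program over the complex numbers. Each
  instruction performs one scalar operation on inputs, the constant \<open>1\<close> or results of earlier
  instructions. No other constants are available, so that all precomputation is counted as well.
\<close>

datatype arith_op = Add | Sub | Mul | Div

datatype 'v operand = Unity | Input 'v | Result nat

datatype 'v instruction = Instr arith_op "'v operand" "'v operand"

datatype 'v program = Program (instructions: "'v instruction list") (outputs: "nat \<Rightarrow> 'v operand")

fun apply_op :: "arith_op \<Rightarrow> complex \<Rightarrow> complex \<Rightarrow> complex option" where
  "apply_op Add x y = Some (x + y)"
| "apply_op Sub x y = Some (x - y)"
| "apply_op Mul x y = Some (x * y)"
| "apply_op Div x y = (if y = 0 then None else Some (x / y))"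

fun operand_value :: "('v \<Rightarrow> complex option) \<Rightarrow> complex list \<Rightarrow> 'v operand \<Rightarrow> complex option" where
  "operand_value env rs Unity = Some 1"
| "operand_value env rs (Input v) = env v"
| "operand_value env rs (Result n) = (if n < length rs then Some (rs ! n) else None)"

fun execute ::
    "('v \<Rightarrow> complex option) \<Rightarrow> complex list \<Rightarrow> 'v instruction list \<Rightarrow> complex list option" where
  "execute env rs [] = Some rs"
| "execute env rs (Instr f x y # is) =
     Option.bind (operand_value env rs x) (\<lambda>u.
     Option.bind (operand_value env rs y) (\<lambda>v.
     Option.bind (apply_op f u v) (\<lambda>w.
     execute env (rs @ [w]) is)))"

definition computes ::
    "'v program \<Rightarrow> ('v \<Rightarrow> complex option) \<Rightarrow> nat set \<Rightarrow> (nat \<Rightarrow> complex) \<Rightarrow> bool" where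
  "computes \<pi> env I f \<longleftrightarrow>
     (\<exists>rs. execute env [] (instructions \<pi>) = Some rs \<and>
           (\<forall>i\<in>I. operand_value env rs (outputs \<pi> i) = Some (f i)))"

definition work :: "'v program \<Rightarrow> nat" where
  "work \<pi> = length (instructions \<pi>)"

datatype ('d::finite) translation_input =
  Theta nat | Center1 'd | Center2 'd | Coeff "nat ^ 'd"

fun translation_env ::
    "(nat \<Rightarrow> nat ^ 'd) \<Rightarrow> (nat ^ 'd \<Rightarrow> complex) \<Rightarrow> nat \<Rightarrow> nat \<Rightarrow> real ^ 'd \<Rightarrow> real ^ 'd \<Rightarrow>
      (nat \<Rightarrow> complex) \<Rightarrow> 'd translation_input \<Rightarrow> complex option" where
  "translation_env \<nu> a c p c1 c2 \<theta> (Theta i) = (if i \<in> stored \<nu> a c p then Some (\<theta> i) else None)"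
| "translation_env \<nu> a c p c1 c2 \<theta> (Center1 k) = Some (of_real (c1 $ k))"
| "translation_env \<nu> a c p c1 c2 \<theta> (Center2 k) = Some (of_real (c2 $ k))"
| "translation_env \<nu> a c p c1 c2 \<theta> (Coeff m) = (if m \<in> mi_upto c then Some (a m) else None)"

definition solves_translation ::
    "(nat \<Rightarrow> nat ^ 'd) \<Rightarrow> (nat ^ 'd \<Rightarrow> complex) \<Rightarrow> nat \<Rightarrow> nat \<Rightarrow> 'd translation_input program \<Rightarrow> bool" where
  "solves_translation \<nu> a c p \<pi> \<longleftrightarrow>
     (\<forall>c1 c2 \<theta>. computes \<pi> (translation_env \<nu> a c p c1 c2 \<theta>) (stored \<nu> a c p)
                  (translated_coeff \<nu> a c p c1 c2 \<theta>))"

end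

theory Submission
  imports Defs
begin

text \<open>
  Let \<open>D\<^sub>q = q! \<gamma>\<^sub>q\<close> be the full array of derivatives at \<open>c1\<close> and \<open>h = c2 - c1\<close>. Written for
  derivatives instead of Taylor coefficients, the translation is the convolution
  \<open>i! \<mu>\<^sub>i = (\<Sum>q\<ge>i. D\<^sub>q (\<Prod>k. h\<^sub>k ^ (q\<^sub>k - i\<^sub>k) / (q\<^sub>k - i\<^sub>k)!))\<close>, whose kernel is a product of \<open>d\<close>
  one-dimensional kernels with only \<open>p + 1\<close> values each. Three observations bound the work.

  The array \<open>D\<close> costs \<open>O(p ^ d)\<close>. Let \<open>m*\<close> be the last multi-index, in the monomial ordering, with
  \<open>a\<^bsub>m*\<^esub> \<noteq> 0\<close>; since the ordering is graded, \<open>|m*| = c\<close>. Since the ordering is compatible with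
  addition, the last nonzero column in the row of \<open>n\<close> is that of \<open>n + m*\<close>
  (\<open>last_nonzero_eq\<close>). So the dropped multi-indices are exactly those with \<open>q \<ge> m*\<close>, and the
  decompression matrix expresses that each row of the differential equation annihilates \<open>D\<close>
  (\<open>pde_derivative\<close>). Solving row \<open>q - m*\<close> for \<open>D\<^sub>q\<close> gives every dropped derivative from a bounded
  number of derivatives that come earlier in the ordering (\<open>derivative_recurrence\<close>).

  The stored multi-indices, being those with \<open>q\<^sub>k < m*\<^sub>k\<close> for some \<open>k\<close>, lie on only \<open>c\<close>
  hyperplanes \<open>q\<^sub>k = r\<close>, each with \<open>O(p ^ (d - 1))\<close> points (\<open>stored_hyperplanes\<close>).

  On one hyperplane \<open>q\<^sub>k = r\<close>, the convolution costs \<open>O(p ^ d)\<close> if it is carried out one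
  coordinate at a time, starting with \<open>k\<close> (\<open>obtainable_translate_hyperplane\<close>). The sums in
  direction \<open>k\<close> use the whole array, but are needed only at the points of the hyperplane; the
  sums in the other directions stay inside the hyperplane. So each of the \<open>d\<close> stages evaluates
  \<open>O(p ^ (d - 1))\<close> sums of at most \<open>p + 1\<close> terms. Translating the whole array in this way would cost
  \<open>O(p ^ (d + 1))\<close>.

  Straight-line programs are handled through the set of functions of the input that they
  have computed so far; \<open>obtainable_imp_program\<close> converts a bound for such a set into a program.
\<close>

section \<open>Operation counts\<close>

text \<open>
  A program computes a value for every input at once, so its state is a set of functions of the
  input \<open>e\<close>. Working with a set instead of a list of results keeps the positions at which
  intermediate results are stored out of all the counting arguments.
\<close>
inductive reachable :: "('e \<Rightarrow> complex) set \<Rightarrow> nat \<Rightarrow> ('e \<Rightarrow> complex) set \<Rightarrow> bool" for S where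
  start: "reachable S 0 S"
| step: "reachable S n T \<Longrightarrow> f \<in> T \<Longrightarrow> g \<in> T \<Longrightarrow> (\<And>e. apply_op op (f e) (g e) = Some (h e)) \<Longrightarrow>
    reachable S (Suc n) (insert h T)"

text \<open>
  In contrast to \<^const>\<open>reachable\<close>, this allows an upper bound on the number of operations and
  forgets auxiliary results, so it can be weakened in all arguments.
\<close>
definition obtainable :: "('e \<Rightarrow> complex) set \<Rightarrow> nat \<Rightarrow> ('e \<Rightarrow> complex) set \<Rightarrow> bool" where
  "obtainable S n T \<longleftrightarrow> (\<exists>m U. m \<le> n \<and> T \<subseteq> U \<and> reachable S m U)"

lemma reachable_extend: "reachable S n T \<Longrightarrow> reachable (S \<union> V) n (T \<union> V)"
proof (induction rule: reachable.induct)
  case start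
  then show ?case by (rule reachable.start)
next
  case (step n T f g op h)
  then have "reachable (S \<union> V) (Suc n) (insert h (T \<union> V))"
    by (intro reachable.step[where f = f and g = g and op = op]) auto
  then show ?case by simp
qed

lemma reachable_superset: "reachable S n T \<Longrightarrow> S \<subseteq> T"
  by (induction rule: reachable.induct) auto

lemma reachable_trans: "reachable T n U \<Longrightarrow> reachable S m T \<Longrightarrow> reachable S (m + n) U"
proof (induction rule: reachable.induct)
  case start
  then show ?case by simp
next
  case (step n T f g op h)
  then show ?case
    using reachable.step[of S "m + n" T f g op h] by simp
qed

lemma obtainable_mono:
  assumes "obtainable S n T" "S \<subseteq> S'" "n \<le> n'" "T' \<subseteq> T"
  shows "obtainable S' n' T'"
proof -
  obtain m U where "m \<le> n" "T \<subseteq> U" "reachable S m U"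
    using assms(1) unfolding obtainable_def by blast
  moreover have "reachable S' m (U \<union> S')"
    using reachable_extend[OF \<open>reachable S m U\<close>, of S'] assms(2) by (simp add: Un_absorb1)
  ultimately show ?thesis
    unfolding obtainable_def using assms(3,4) by (meson le_supI1 order_trans)
qed

lemma obtainable_subset: "T \<subseteq> S \<Longrightarrow> obtainable S 0 T"
  unfolding obtainable_def using reachable.start by blast

lemma obtainable_Un:
  assumes "obtainable S m T" "obtainable (S \<union> T) n U"
  shows "obtainable S (m + n) (T \<union> U)"
proof -
  obtain m' T' where T': "m' \<le> m" "T \<subseteq> T'" "reachable S m' T'"
    using assms(1) unfolding obtainable_def by blast
  have "S \<union> T \<subseteq> T'"
    using T' reachable_superset by blast
  with assms(2) obtain n' U' where U': "n' \<le> n" "U \<subseteq> U'" "reachable T' n' U'"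
    unfolding obtainable_def by (metis (lifting) obtainable_def obtainable_mono order_refl)
  have "reachable S (m' + n') U'"
    using reachable_trans U'(3) T'(3) .
  moreover have "T \<union> U \<subseteq> U'"
    using T' U' reachable_superset by blast
  ultimately show ?thesis
    unfolding obtainable_def using T' U' by (meson add_mono)
qed

lemma obtainable_trans:
  assumes "obtainable S m T" "obtainable (S \<union> T) n U"
  shows "obtainable S (m + n) U"
  using obtainable_mono[OF obtainable_Un[OF assms]] by blast

lemma obtainable_op:
  assumes "f \<in> S" "g \<in> S" "\<And>e. apply_op op (f e) (g e) = Some (h e)"
  shows "obtainable S 1 {h}"
  unfolding obtainable_def
  using reachable.step[OF reachable.start assms] by (intro exI[of _ 1]) (auto simp: One_nat_def)

lemma obtainable_add: "f \<in> S \<Longrightarrow> g \<in> S \<Longrightarrow> obtainable S 1 {\<lambda>e. f e + g e}"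
  and obtainable_diff: "f \<in> S \<Longrightarrow> g \<in> S \<Longrightarrow> obtainable S 1 {\<lambda>e. f e - g e}"
  and obtainable_mult: "f \<in> S \<Longrightarrow> g \<in> S \<Longrightarrow> obtainable S 1 {\<lambda>e. f e * g e}"
  and obtainable_divide:
    "f \<in> S \<Longrightarrow> g \<in> S \<Longrightarrow> (\<And>e. g e \<noteq> 0) \<Longrightarrow> obtainable S 1 {\<lambda>e. f e / g e}"
  using obtainable_op[of f S g Add] obtainable_op[of f S g Sub]
    obtainable_op[of f S g Mul] obtainable_op[of f S g Div] by simp_all

lemma obtainable_UN:
  assumes "finite I" "\<And>i. i \<in> I \<Longrightarrow> obtainable S n (T i)"
  shows "obtainable S (card I * n) (\<Union>i\<in>I. T i)"
  using assms
proof (induction rule: finite_induct)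
  case empty
  then show ?case by (simp add: obtainable_subset)
next
  case (insert i I)
  have "obtainable S (card I * n + n) ((\<Union>i\<in>I. T i) \<union> T i)"
    using insert by (intro obtainable_Un obtainable_mono[of S n "T i" "S \<union> (\<Union>i\<in>I. T i)"]) auto
  then show ?case
    using insert by (simp add: add.commute Un_commute)
qed

lemma obtainable_image:
  assumes "finite I" "\<And>i. i \<in> I \<Longrightarrow> obtainable S n {f i}"
  shows "obtainable S (card I * n) (f ` I)"
  using obtainable_UN[of I S n "\<lambda>i. {f i}"] assms by (simp add: UNION_singleton_eq_range)

text \<open>
  The counting rule for recurrences: each value may use all earlier values of the sequence.
\<close>
lemma obtainable_sequence:
  assumes "\<And>m. m < n \<Longrightarrow> obtainable (S \<union> f ` {..<m}) b {f m}"
  shows "obtainable S (n * b) (f ` {..<n})"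
  using assms
proof (induction n)
  case 0
  then show ?case by (simp add: obtainable_subset)
next
  case (Suc n)
  have "obtainable S (n * b + b) (f ` {..<n} \<union> {f n})"
    using Suc by (intro obtainable_Un) auto
  then show ?case
    by (simp add: lessThan_Suc add.commute)
qed

lemma obtainable_zero: "(\<lambda>e. 1) \<in> S \<Longrightarrow> obtainable S 1 {\<lambda>e. 0}"
  using obtainable_diff[of "\<lambda>e. 1" S "\<lambda>e. 1"] by simp

lemma obtainable_uminus:
  assumes "(\<lambda>e. 1) \<in> S" "f \<in> S"
  shows "obtainable S (1 + 1) {\<lambda>e. - f e}"
proof -
  have "obtainable (S \<union> {\<lambda>e. 0}) 1 {\<lambda>e. 0 - f e}"
    using assms(2) by (intro obtainable_diff) auto
  from obtainable_trans[OF obtainable_zero[OF assms(1)] this] show ?thesis by simp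
qed

lemma obtainable_sum_mult:
  assumes "finite I" "\<And>i. i \<in> I \<Longrightarrow> f i \<in> S" "\<And>i. i \<in> I \<Longrightarrow> g i \<in> S" "(\<lambda>e. 1) \<in> S"
  shows "obtainable S (2 * card I + 1) {\<lambda>e. \<Sum>i\<in>I. f i e * g i e}"
  using assms(1-3)
proof (induction rule: finite_induct)
  case empty
  then show ?case using obtainable_zero[OF assms(4)] by simp
next
  case (insert i I)
  let ?s = "\<lambda>e. \<Sum>i\<in>I. f i e * g i e" and ?t = "\<lambda>e. f i e * g i e"
  have "obtainable (S \<union> {?s}) (1 + 1) {\<lambda>e. ?t e + ?s e}"
    using insert by (intro obtainable_trans[OF obtainable_mult[of "f i" _ "g i"]] obtainable_add) auto
  then have "obtainable S ((2 * card I + 1) + (1 + 1)) {\<lambda>e. ?t e + ?s e}"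
    using insert by (intro obtainable_trans[of S "2 * card I + 1" "{?s}"]) auto
  then show ?case
    using insert by simp
qed

lemma obtainable_prod:
  assumes "finite I" "\<And>i. i \<in> I \<Longrightarrow> f i \<in> S" "(\<lambda>e. 1) \<in> S"
  shows "obtainable S (card I) {\<lambda>e. \<Prod>i\<in>I. f i e}"
  using assms(1,2)
proof (induction rule: finite_induct)
  case empty
  then show ?case using assms(3) by (simp add: obtainable_subset)
next
  case (insert i I)
  have "obtainable S (card I + 1) {\<lambda>e. f i e * (\<Prod>i\<in>I. f i e)}"
    using insert
    by (intro obtainable_trans[of S "card I" "{\<lambda>e. \<Prod>i\<in>I. f i e}"] obtainable_mult) auto
  then show ?case
    using insert by simp
qed

lemma obtainable_of_nat:
  assumes "(\<lambda>e. 1) \<in> S"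
  shows "obtainable S n ((\<lambda>m e. of_nat m) ` {..<n})"
proof -
  have "obtainable (S \<union> (\<lambda>m e. of_nat m) ` {..<m}) 1 {\<lambda>e. of_nat m}" for m
  proof (cases m)
    case 0
    then show ?thesis using obtainable_zero[OF assms] by simp
  next
    case (Suc m')
    have "obtainable (S \<union> (\<lambda>m e. of_nat m) ` {..<m}) 1 {\<lambda>e. of_nat m' + 1}"
      using assms Suc by (intro obtainable_add) auto
    then show ?thesis
      using Suc by (simp add: add.commute)
  qed
  then have "obtainable S (n * 1) ((\<lambda>m e. of_nat m) ` {..<n})"
    by (intro obtainable_sequence)
  then show ?thesis by simp
qed

text \<open>
  Each value comes from the previous one by a multiplication by \<open>g\<close> and a division by \<open>m\<close>; the
  divisors themselves have to be counted up from \<open>1\<close>, which is the third operation.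
\<close>
lemma obtainable_power_over_fact:
  assumes "(\<lambda>e. 1) \<in> S" "g \<in> S"
  shows "obtainable S (3 * n) ((\<lambda>m e. g e ^ m / fact m) ` {..<n})"
proof -
  let ?f = "\<lambda>m e. g e ^ m / fact m :: complex"
  let ?N = "(\<lambda>m e. of_nat m) ` {..<n} :: ('a \<Rightarrow> complex) set"
  have "obtainable (S \<union> ?N \<union> ?f ` {..<m}) 2 {?f m}" if "m < n" for m
  proof (cases m)
    case 0
    have "obtainable (S \<union> ?N \<union> ?f ` {..<m}) 0 {?f m}"
      using assms 0 by (intro obtainable_subset) simp
    then show ?thesis by (rule obtainable_mono) auto
  next
    case (Suc m')
    let ?T = "S \<union> ?N \<union> ?f ` {..<m}"
    have mem: "?f m' \<in> ?T" "g \<in> ?T" "(\<lambda>e. of_nat m) \<in> ?T"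
      using assms Suc that by blast+
    have "obtainable ?T (1 + 1) {\<lambda>e. ?f m' e * g e / of_nat m}"
      using mem Suc
      by (intro obtainable_trans[OF obtainable_mult[of "?f m'" _ g]] obtainable_divide)
        (auto simp del: of_nat_Suc)
    moreover have "(\<lambda>e. ?f m' e * g e / of_nat m) = ?f m"
      using Suc by (simp add: field_simps del: of_nat_Suc)
    ultimately show ?thesis by (simp add: numeral_2_eq_2)
  qed
  then have "obtainable (S \<union> ?N) (n * 2) (?f ` {..<n})"
    by (intro obtainable_sequence)
  from obtainable_trans[OF obtainable_of_nat[OF assms(1), of n] this]
  show ?thesis by (rule obtainable_mono) auto
qed

lemma obtainable_fact:
  assumes "(\<lambda>e. 1) \<in> S"
  shows "obtainable S (2 * n) ((\<lambda>m e. fact m) ` {..<n})"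
proof -
  let ?f = "\<lambda>m e. fact m :: complex"
  let ?N = "(\<lambda>m e. of_nat m) ` {..<n} :: ('a \<Rightarrow> complex) set"
  have "obtainable (S \<union> ?N \<union> ?f ` {..<m}) 1 {?f m}" if "m < n" for m
  proof (cases m)
    case 0
    have "obtainable (S \<union> ?N \<union> ?f ` {..<m}) 0 {?f m}"
      using assms 0 by (intro obtainable_subset) simp
    then show ?thesis by (rule obtainable_mono) auto
  next
    case (Suc m')
    have "obtainable (S \<union> ?N \<union> ?f ` {..<m}) 1 {\<lambda>e. of_nat m * ?f m' e}"
      using Suc that by (intro obtainable_mult) blast+
    then show ?thesis using Suc by simp
  qed
  then have "obtainable (S \<union> ?N) (n * 1) (?f ` {..<n})"
    by (intro obtainable_sequence)
  from obtainable_trans[OF obtainable_of_nat[OF assms(1), of n] this]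
  show ?thesis by (rule obtainable_mono) auto
qed

definition given :: "('e \<Rightarrow> 'v \<Rightarrow> complex option) \<Rightarrow> ('e \<Rightarrow> complex) set" where
  "given env = insert (\<lambda>e. 1) {f. \<exists>v. \<forall>e. env e v = Some (f e)}"

lemma execute_append:
  "execute env rs (is @ js) = Option.bind (execute env rs is) (\<lambda>rs'. execute env rs' js)"
  by (induction env rs "is" rule: execute.induct)
    (auto simp: Option.bind_eq_Some_conv split: Option.bind_split)

text \<open>
  The operand for a function must be chosen before the input is known, hence the quantifier
  order \<open>\<exists>x. \<forall>e\<close>. New instructions are appended at the end, so earlier operands stay valid.
\<close>
lemma reachable_imp_program:
  assumes "reachable (given env) n T"
  shows "\<exists>is R. length is = n \<and> (\<forall>e. execute (env e) [] is = Some (R e) \<and> length (R e) = n) \<and>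
           (\<forall>f\<in>T. \<exists>x. \<forall>e. operand_value (env e) (R e) x = Some (f e))"
  using assms
proof (induction rule: reachable.induct)
  case start
  have "\<exists>x. \<forall>e. operand_value (env e) [] x = Some (f e)" if f: "f \<in> given env" for f
  proof (cases "f = (\<lambda>e. 1)")
    case True
    then show ?thesis by (intro exI[of _ Unity]) simp
  next
    case False
    then obtain v where "\<forall>e. env e v = Some (f e)"
      using f unfolding given_def by blast
    then show ?thesis by (intro exI[of _ "Input v"]) simp
  qed
  then show ?case
    by (intro exI[of _ "[]"] exI[of _ "\<lambda>e. []"]) auto
next
  case (step n T f g op h)
  then obtain "is" R where 1: "length is = n"
    "\<And>e. execute (env e) [] is = Some (R e)" "\<And>e. length (R e) = n"
    "\<And>f. f \<in> T \<Longrightarrow> \<exists>x. \<forall>e. operand_value (env e) (R e) x = Some (f e)"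
    by metis
  obtain x y where xy: "\<And>e. operand_value (env e) (R e) x = Some (f e)"
    "\<And>e. operand_value (env e) (R e) y = Some (g e)"
    using 1(4) step.hyps by metis
  let ?is = "is @ [Instr op x y]" and ?R = "\<lambda>e. R e @ [h e]"
  have "execute (env e) [] ?is = Some (?R e)" for e
    using 1(2)[of e] xy step.hyps(4)[of e] by (simp add: execute_append)
  moreover have "\<exists>x. \<forall>e. operand_value (env e) (?R e) x = Some (f' e)" if "f' \<in> insert h T" for f'
  proof (cases "f' = h")
    case True
    then show ?thesis
      using 1(3) by (intro exI[of _ "Result n"]) (simp add: nth_append)
  next
    case False
    then obtain z where z: "\<And>e. operand_value (env e) (R e) z = Some (f' e)"
      using \<open>f' \<in> insert h T\<close> 1(4) by blast
    have "operand_value (env e) (?R e) z = Some (f' e)" for e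
      using z[of e] by (cases z) (auto simp: nth_append split: if_splits)
    then show ?thesis by blast
  qed
  ultimately show ?case
    using 1 by (intro exI[of _ ?is] exI[of _ ?R]) auto
qed

lemma obtainable_imp_program:
  assumes "obtainable (given env) n (f ` I)"
  shows "\<exists>\<pi>. work \<pi> \<le> n \<and> (\<forall>e. computes \<pi> (env e) I (\<lambda>i. f i e))"
proof -
  obtain m U where U: "m \<le> n" "f ` I \<subseteq> U" "reachable (given env) m U"
    using assms unfolding obtainable_def by blast
  obtain "is" R where R: "length is = m" "\<And>e. execute (env e) [] is = Some (R e)"
    "\<And>g. g \<in> U \<Longrightarrow> \<exists>x. \<forall>e. operand_value (env e) (R e) x = Some (g e)"
    using reachable_imp_program[OF U(3)] by metis
  have "\<exists>out. \<forall>i\<in>I. \<forall>e. operand_value (env e) (R e) (out i) = Some (f i e)"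
    using R(3) U(2) by (intro bchoice) blast
  then obtain out where "\<And>i e. i \<in> I \<Longrightarrow> operand_value (env e) (R e) (out i) = Some (f i e)"
    by blast
  then show ?thesis
    using R U by (intro exI[of _ "Program is out"]) (auto simp: work_def computes_def)
qed

section \<open>Multi-indices\<close>

lemma card_mi_box:
  assumes "\<And>k. finite (B k)"
  shows "finite {q :: nat ^ 'd. \<forall>k. q $ k \<in> B k}"
    and "card {q :: nat ^ 'd. \<forall>k. q $ k \<in> B k} = (\<Prod>k\<in>UNIV. card (B k))"
proof -
  have eq: "{q :: nat ^ 'd. \<forall>k. q $ k \<in> B k} = vec_lambda ` (PiE UNIV B)"
  proof (intro set_eqI iffI)
    fix q :: "nat ^ 'd" assume "q \<in> {q. \<forall>k. q $ k \<in> B k}"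
    then show "q \<in> vec_lambda ` (PiE UNIV B)"
      by (intro image_eqI[of _ _ "vec_nth q"]) auto
  qed auto
  show "finite {q :: nat ^ 'd. \<forall>k. q $ k \<in> B k}"
    unfolding eq using assms by (intro finite_imageI finite_PiE) auto
  have "inj_on vec_lambda (PiE UNIV B)"
    by (auto intro!: inj_onI simp: vec_eq_iff)
  then show "card {q :: nat ^ 'd. \<forall>k. q $ k \<in> B k} = (\<Prod>k\<in>UNIV. card (B k))"
    unfolding eq by (simp add: card_image card_PiE)
qed

lemma mi_abs_component_le: "q $ k \<le> mi_abs q"
  unfolding mi_abs_def by (intro member_le_sum) auto

lemma mi_abs_add: "mi_abs (q + r) = mi_abs q + mi_abs r"
  unfolding mi_abs_def by (simp add: sum.distrib)

lemma mi_abs_axis: "mi_abs (axis k n) = n"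
  unfolding mi_abs_def axis_def by simp

lemma mi_add_diff: "q \<le> r \<Longrightarrow> q + (r - q) = (r :: nat ^ 'd)"
  by (simp add: vec_eq_iff less_eq_vec_def)

lemma mi_add_diff_left: "(q + r) - q = (r :: nat ^ 'd)"
  by (simp add: vec_eq_iff)

lemma mi_le_add: "q \<le> q + (r :: nat ^ 'd)" "q \<le> r + (q :: nat ^ 'd)"
  by (simp_all add: less_eq_vec_def)

lemma mi_abs_mono: "q \<le> r \<Longrightarrow> mi_abs q \<le> mi_abs (r :: nat ^ 'd)"
  unfolding mi_abs_def less_eq_vec_def by (intro sum_mono) auto

lemma finite_mi_upto: "finite (mi_upto p :: (nat ^ 'd) set)"
proof (rule finite_subset)
  show "mi_upto p \<subseteq> {q :: nat ^ 'd. \<forall>k. q $ k \<in> {..p}}"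
    using mi_abs_component_le order_trans unfolding mi_upto_def by blast
qed (intro card_mi_box, simp)

lemma num_mi_le: "num_mi TYPE('d::finite) p \<le> (p + 1) ^ CARD('d)"
proof -
  have "card (mi_upto p :: (nat ^ 'd) set) \<le> card {q :: nat ^ 'd. \<forall>k. q $ k \<in> {..p}}"
    unfolding mi_upto_def
    by (intro card_mono card_mi_box) (auto intro: order_trans[OF mi_abs_component_le])
  then show ?thesis
    by (simp add: card_mi_box[where B = "\<lambda>k. {..p}", simplified] num_mi_def)
qed

text \<open>
  Fixing one coordinate lowers the exponent by one; this is where the translation saves its
  factor \<open>p\<close>.
\<close>
lemma card_mi_hyperplane_le:
  "finite {q :: nat ^ 'd. mi_abs q \<le> p \<and> q $ k = r}"
  "card {q :: nat ^ 'd. mi_abs q \<le> p \<and> q $ k = r} \<le> (p + 1) ^ (CARD('d) - 1)"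
proof -
  let ?B = "\<lambda>l. if l = k then {r} else {..p}"
  have sub: "{q :: nat ^ 'd. mi_abs q \<le> p \<and> q $ k = r} \<subseteq> {q. \<forall>l. q $ l \<in> ?B l}"
    by (auto intro: order_trans[OF mi_abs_component_le])
  have fin: "finite (?B l)" for l by simp
  show "finite {q :: nat ^ 'd. mi_abs q \<le> p \<and> q $ k = r}"
    by (rule finite_subset[OF sub card_mi_box(1)[OF fin]])
  have "card {q :: nat ^ 'd. mi_abs q \<le> p \<and> q $ k = r} \<le> (\<Prod>l\<in>UNIV. card (?B l))"
    unfolding card_mi_box(2)[OF fin, symmetric]
    by (rule card_mono[OF card_mi_box(1)[OF fin] sub])
  also have "(\<Prod>l\<in>UNIV. card (?B l)) = (\<Prod>l\<in>UNIV - {k}. card (?B l))"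
    by (subst prod.remove[of UNIV k]) auto
  also have "\<dots> = (\<Prod>l\<in>UNIV - {k}. p + 1)"
    by (intro prod.cong) auto
  finally show "card {q :: nat ^ 'd. mi_abs q \<le> p \<and> q $ k = r} \<le> (p + 1) ^ (CARD('d) - 1)"
    by (simp add: card_Diff_singleton)
qed

definition translation_kernel :: "real ^ 'd \<Rightarrow> 'd \<Rightarrow> nat \<Rightarrow> complex" where
  "translation_kernel x k n = of_real (x $ k) ^ n / fact n"

text \<open>
  Since \<open>binomial q i / q! = 1 / (i! (q - i)!)\<close>, the coefficient of the translation depends on \<open>q\<close>
  and \<open>i\<close> only through \<open>q - i\<close>, up to the factor \<open>1 / i!\<close>, and it is a product over the coordinates.
  This avoids a table of binomial coefficients, which would be too large in one dimension.
\<close>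
lemma taylor_shift_term_eq:
  fixes i :: "nat ^ 'd"
  assumes "i \<le> q"
  shows "u / of_nat (mi_fact q) * of_nat (mi_binomial q i) * of_real (mi_power x (q - i)) =
    (u * (\<Prod>k\<in>UNIV. translation_kernel x k (q $ k - i $ k))) / (\<Prod>k\<in>UNIV. fact (i $ k))"
proof -
  have "complex_of_nat (mi_binomial q i)
     = (\<Prod>k\<in>UNIV. fact (q $ k) / (fact (i $ k) * fact (q $ k - i $ k)))"
    using assms unfolding mi_binomial_def less_eq_vec_def of_nat_prod
    by (intro prod.cong) (auto simp: binomial_fact)
  moreover have "complex_of_nat (mi_fact q) = (\<Prod>k\<in>UNIV. fact (q $ k))"
    unfolding mi_fact_def by simp
  moreover have "(\<Prod>k\<in>UNIV. fact (q $ k) :: complex) \<noteq> 0"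
    by simp
  ultimately show ?thesis
    by (simp add: mi_power_def translation_kernel_def prod_dividef prod.distrib divide_simps mult_ac)
qed

section \<open>Translation one coordinate at a time\<close>

text \<open>
  The intermediate result in which only the coordinates in \<open>K\<close> have been translated. For
  \<open>K = UNIV\<close> it is the complete convolution of the derivatives \<open>D\<close> with the kernels \<open>w\<close>.
\<close>
definition translate_along ::
    "nat \<Rightarrow> (nat ^ 'd \<Rightarrow> complex) \<Rightarrow> ('d \<Rightarrow> nat \<Rightarrow> complex) \<Rightarrow> 'd set \<Rightarrow> nat ^ 'd \<Rightarrow> complex" where
  "translate_along p D w K i =
     (\<Sum>q | mi_abs q \<le> p \<and> i \<le> q \<and> (\<forall>k. k \<notin> K \<longrightarrow> q $ k = i $ k).
        D q * (\<Prod>k\<in>K. w k (q $ k - i $ k)))"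

lemma translate_along_empty:
  assumes "mi_abs i \<le> p"
  shows "translate_along p D w {} i = D i"
proof -
  have "{q. mi_abs q \<le> p \<and> i \<le> q \<and> (\<forall>k. k \<notin> {} \<longrightarrow> q $ k = i $ k)} = {i}"
    using assms by (auto simp: vec_eq_iff less_eq_vec_def)
  then show ?thesis
    unfolding translate_along_def by simp
qed

text \<open>
  The multi-indices that contribute to the left-hand side are grouped by the distance
  \<open>n = q\<^sub>k - i\<^sub>k\<close>; each group is a translation along \<open>K\<close> from the point that is shifted by \<open>n\<close>.
\<close>
lemma translate_along_insert:
  fixes i :: "nat ^ 'd"
  assumes "k \<notin> K"
  shows "translate_along p D w (insert k K) i =
    (\<Sum>n | mi_abs i + n \<le> p. w k n * translate_along p D w K (i + axis k n))"
proof -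
  let ?Q = "\<lambda>K i. {q :: nat ^ 'd. mi_abs q \<le> p \<and> i \<le> q \<and> (\<forall>k. k \<notin> K \<longrightarrow> q $ k = i $ k)}"
  let ?N = "{n. mi_abs i + n \<le> p}"
  have finQ: "finite (?Q K i)" for K i
    by (rule finite_subset[OF _ finite_mi_upto[of p]]) (auto simp: mi_upto_def)
  have finN: "finite ?N"
    by (rule finite_subset[of _ "{..p}"]) auto
  have K: "finite K" by simp
  have ax: "(i + axis k n) $ l = (if l = k then i $ k + n else i $ l)" for n l
    by (simp add: axis_def)
  have "(\<Sum>n\<in>?N. w k n * translate_along p D w K (i + axis k n)) =
    (\<Sum>(n, q)\<in>Sigma ?N (\<lambda>n. ?Q K (i + axis k n)).
       w k n * (D q * (\<Prod>l\<in>K. w l (q $ l - (i + axis k n) $ l))))"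
    unfolding translate_along_def sum_distrib_left
    by (subst sum.Sigma, rule finN, use finQ in blast, rule refl)
  also have "\<dots> = (\<Sum>q\<in>?Q (insert k K) i. D q * (\<Prod>l\<in>insert k K. w l (q $ l - i $ l)))"
  proof (rule sum.reindex_bij_witness[where j = snd and i = "\<lambda>q. (q $ k - i $ k, q)"])
    fix x assume x: "x \<in> Sigma ?N (\<lambda>n. ?Q K (i + axis k n))"
    then obtain n q where nq: "x = (n, q)" "q \<in> ?Q K (i + axis k n)" by auto
    then have qk: "q $ k = i $ k + n"
      using assms ax by auto
    then show "(snd x $ k - i $ k, snd x) = x" using nq by simp
    show "snd x \<in> ?Q (insert k K) i"
      using nq ax by (auto simp: less_eq_vec_def split: if_splits)
        (metis add_leD1 ax)+
    have "(\<Prod>l\<in>K. w l (q $ l - (i + axis k n) $ l)) = (\<Prod>l\<in>K. w l (q $ l - i $ l))"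
      using assms by (intro prod.cong) (auto simp: axis_def)
    then show "D (snd x) * (\<Prod>l\<in>insert k K. w l (snd x $ l - i $ l)) =
      (case x of (n, q) \<Rightarrow> w k n * (D q * (\<Prod>l\<in>K. w l (q $ l - (i + axis k n) $ l))))"
      using nq qk assms K by simp
  next
    fix q assume q: "q \<in> ?Q (insert k K) i"
    then have "i $ k \<le> q $ k"
      by (simp add: less_eq_vec_def)
    then have le: "i + axis k (q $ k - i $ k) \<le> q"
      using q unfolding less_eq_vec_def ax by auto
    have "mi_abs i + (q $ k - i $ k) \<le> p"
      using mi_abs_mono[OF le] q by (simp add: mi_abs_add mi_abs_axis)
    then show "(q $ k - i $ k, q) \<in> Sigma ?N (\<lambda>n. ?Q K (i + axis k n))"
      using q le \<open>i $ k \<le> q $ k\<close> by (auto simp: axis_def)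
  qed auto
  finally show ?thesis
    unfolding translate_along_def by simp
qed

lemma obtainable_translate_step:
  fixes D :: "'e \<Rightarrow> nat ^ 'd \<Rightarrow> complex" and w :: "'e \<Rightarrow> 'd \<Rightarrow> nat \<Rightarrow> complex"
  assumes "k \<notin> K"
    and one: "(\<lambda>e. 1) \<in> S" and w: "\<And>n. n \<le> p \<Longrightarrow> (\<lambda>e. w e k n) \<in> S"
    and prev: "\<And>n. mi_abs i + n \<le> p \<Longrightarrow>
      (\<lambda>e. translate_along p (D e) (w e) K (i + axis k n)) \<in> S"
  shows "obtainable S (2 * p + 3) {\<lambda>e. translate_along p (D e) (w e) (insert k K) i}"
proof -
  let ?N = "{n. mi_abs i + n \<le> p}"
  have sub: "?N \<subseteq> {..p}" by auto
  have fin: "finite ?N" by (rule finite_subset[OF sub]) simp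
  have "card ?N \<le> p + 1"
    using card_mono[OF _ sub] by simp
  then show ?thesis
    unfolding translate_along_insert[OF assms(1)]
    using obtainable_sum_mult[of ?N "\<lambda>n e. w e k n" S
        "\<lambda>n e. translate_along p (D e) (w e) K (i + axis k n)"]
    by (rule_tac obtainable_mono) (use fin one w prev in auto)
qed

text \<open>
  The order of the coordinates matters: \<open>k\<close> must come first. Translation in direction \<open>k\<close> is the
  only stage that reads values off the hyperplane, and at that time those are the given \<open>D\<close>. A shift
  in any other direction keeps \<open>q\<^sub>k = r\<close>, so the later stages need the earlier results only on
  the hyperplane itself.
\<close>
lemma obtainable_translate_hyperplane:
  fixes D :: "'e \<Rightarrow> nat ^ 'd \<Rightarrow> complex" and w :: "'e \<Rightarrow> 'd \<Rightarrow> nat \<Rightarrow> complex" and r :: nat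
  assumes one: "(\<lambda>e. 1) \<in> S" and w: "\<And>k n. n \<le> p \<Longrightarrow> (\<lambda>e. w e k n) \<in> S"
    and D: "\<And>q. mi_abs q \<le> p \<Longrightarrow> (\<lambda>e. D e q) \<in> S"
  shows "obtainable S (CARD('d) * ((p + 1) ^ (CARD('d) - 1) * (2 * p + 3)))
    ((\<lambda>i e. translate_along p (D e) (w e) UNIV i) ` {q. mi_abs q \<le> p \<and> q $ k = r})"
proof -
  let ?H = "{q :: nat ^ 'd. mi_abs q \<le> p \<and> q $ k = r}"
  let ?T = "\<lambda>K i e. translate_along p (D e) (w e) K i"
  let ?b = "(p + 1) ^ (CARD('d) - 1) * (2 * p + 3)"
  have layer: "obtainable S' ?b (?T (insert l K) ` ?H)"
    if "l \<notin> K" "S \<subseteq> S'"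
      "\<And>i n. i \<in> ?H \<Longrightarrow> mi_abs i + n \<le> p \<Longrightarrow> ?T K (i + axis l n) \<in> S'" for l K S'
  proof (rule obtainable_mono)
    show "obtainable S' (card ?H * (2 * p + 3)) (?T (insert l K) ` ?H)"
      using that one w
      by (intro obtainable_image obtainable_translate_step card_mi_hyperplane_le) auto
  qed (use card_mi_hyperplane_le(2)[of p k r] in auto)
  have "obtainable S ((1 + card K) * ?b) (?T (insert k K) ` ?H)" if "K \<subseteq> UNIV - {k}" for K
    using finite[of K] that
  proof (induction rule: finite_induct)
    case empty
    have "?T {} (i + axis k n) \<in> S" if "mi_abs i + n \<le> p" for i n
      using D[of "i + axis k n"] that
      by (simp add: translate_along_empty mi_abs_add mi_abs_axis)
    then show ?case
      using layer[of k "{}" S] by simp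
  next
    case (insert l K)
    have IH: "obtainable S ((1 + card K) * ?b) (?T (insert k K) ` ?H)"
      using insert by auto
    have "obtainable (S \<union> ?T (insert k K) ` ?H) ?b (?T (insert l (insert k K)) ` ?H)"
    proof (rule layer)
      fix i n assume i: "i \<in> ?H" "mi_abs i + n \<le> p"
      have "i + axis l n \<in> ?H"
        using i insert by (simp add: mi_abs_add mi_abs_axis) (auto simp: axis_def)
      then show "?T (insert k K) (i + axis l n) \<in> S \<union> ?T (insert k K) ` ?H"
        by blast
    qed (use insert in auto)
    from obtainable_trans[OF IH this] show ?case
      using insert by (simp add: insert_commute algebra_simps)
  qed
  from this[of "UNIV - {k}"] show ?thesis
    by (simp add: insert_UNIV insert_absorb card_Diff_singleton del: mult_Suc)
qed

section \<open>Triangular systems\<close>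

text \<open>
  By bordering: the inverse for \<open>n + 1\<close> extends the inverse \<open>B\<close> for \<open>n\<close> by the last row
  \<open>(- v, 1) / A\<^bsub>n+1,n+1\<^esub>\<close>, where \<open>v\<close> is the row vector \<open>A\<^bsub>n+1,1..n\<^esub> B\<close>, and a last column that is
  otherwise zero.
\<close>
lemma lower_triangular_inverse_exists:
  fixes A :: "nat \<Rightarrow> nat \<Rightarrow> complex"
  assumes "\<And>i j. 1 \<le> i \<Longrightarrow> i < j \<Longrightarrow> A i j = 0" "\<And>i. 1 \<le> i \<Longrightarrow> A i i \<noteq> 0"
  shows "\<exists>B. matrix_inverse_on {1..n} {1..n} A B"
proof (induction n)
  case 0
  then show ?case by (simp add: matrix_inverse_on_def)
next
  case (Suc n)
  then obtain B where "matrix_inverse_on {1..n} {1..n} A B" ..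
  then have
    AB: "\<And>i j. i \<in> {1..n} \<Longrightarrow> j \<in> {1..n} \<Longrightarrow> (\<Sum>k\<in>{1..n}. A i k * B k j) = (if i = j then 1 else 0)" and
    BA: "\<And>i j. i \<in> {1..n} \<Longrightarrow> j \<in> {1..n} \<Longrightarrow> (\<Sum>k\<in>{1..n}. B i k * A k j) = (if i = j then 1 else 0)"
    by (simp_all add: matrix_inverse_on_def)
  let ?N = "Suc n"
  define v where "v = (\<lambda>j. \<Sum>k\<in>{1..n}. A ?N k * B k j)"
  define C where "C = (\<lambda>i j. if i = ?N then (if j = ?N then 1 else - v j) / A ?N ?N
    else if j = ?N then 0 else B i j)"
  have C: "C ?N ?N = 1 / A ?N ?N" "\<And>j. j \<le> n \<Longrightarrow> C ?N j = - v j / A ?N ?N"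
    "\<And>i. i \<le> n \<Longrightarrow> C i ?N = 0" "\<And>i j. i \<le> n \<Longrightarrow> j \<le> n \<Longrightarrow> C i j = B i j"
    by (simp_all add: C_def)
  have split: "(\<Sum>k\<in>{1..?N}. f k) = (\<Sum>k\<in>{1..n}. f k) + f ?N" for f :: "nat \<Rightarrow> complex"
    by simp
  have vA: "(\<Sum>k\<in>{1..n}. v k * A k j) = A ?N j" if "j \<in> {1..n}" for j
  proof -
    have "(\<Sum>k\<in>{1..n}. v k * A k j) = (\<Sum>l\<in>{1..n}. A ?N l * (\<Sum>k\<in>{1..n}. B l k * A k j))"
      unfolding v_def sum_distrib_left sum_distrib_right by (subst sum.swap) (simp add: mult.assoc)
    also have "\<dots> = (\<Sum>l\<in>{1..n}. if l = j then A ?N l else 0)"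
      using BA that by (intro sum.cong) auto
    also have "\<dots> = A ?N j"
      using that by simp
    finally show ?thesis .
  qed
  have "(\<Sum>k\<in>{1..?N}. A i k * C k j) = (if i = j then 1 else 0)"
    if ij: "i \<in> {1..?N}" "j \<in> {1..?N}" for i j
  proof -
    consider "i \<le> n" "j \<le> n" | "i \<le> n" "j = ?N" | "i = ?N" "j \<le> n" | "i = ?N" "j = ?N"
      using ij by fastforce
    then show ?thesis
      using ij AB[of i j] assms(2)[of ?N] assms(1)[of i ?N] unfolding split
      by cases (auto simp: C v_def)
  qed
  moreover have "(\<Sum>k\<in>{1..?N}. C i k * A k j) = (if i = j then 1 else 0)"
    if ij: "i \<in> {1..?N}" "j \<in> {1..?N}" for i j
  proof -
    consider "i \<le> n" "j \<le> n" | "i \<le> n" "j = ?N" | "i = ?N" "j \<le> n" | "i = ?N" "j = ?N"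
      using ij by fastforce
    then show ?thesis
    proof cases
      case 3
      then have "(\<Sum>k\<in>{1..n}. C i k * A k j) = - (\<Sum>k\<in>{1..n}. v k * A k j) / A ?N ?N"
        by (simp add: C sum_negf sum_divide_distrib)
      then show ?thesis
        using 3 ij vA[of j] unfolding split by (simp add: C)
    qed (use ij BA[of i j] assms(2)[of ?N] assms(1) in \<open>auto simp: C split\<close>)
  qed
  ultimately show ?case
    unfolding matrix_inverse_on_def by blast
qed

section \<open>Graded monomial orderings\<close>

locale monomial_ordering =
  fixes \<nu> :: "nat \<Rightarrow> nat ^ 'd"
  assumes ordering: "graded_monomial_ordering \<nu>"
begin

abbreviation index :: "nat ^ 'd \<Rightarrow> nat" where
  "index \<equiv> mi_index \<nu>"

lemma bij_\<nu>: "bij_betw \<nu> {1..} UNIV"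
  using ordering by (simp add: graded_monomial_ordering_def)

lemma \<nu>_index [simp]: "\<nu> (index q) = q"
  unfolding mi_index_def using bij_\<nu> by (intro f_inv_into_f) (auto simp: bij_betw_def)

lemma index_\<nu>: "i \<ge> 1 \<Longrightarrow> index (\<nu> i) = i"
  unfolding mi_index_def using bij_\<nu> by (intro inv_into_f_f) (auto simp: bij_betw_def)

lemma index_ge_1: "index q \<ge> 1"
proof -
  have "q \<in> \<nu> ` {1..}"
    using bij_\<nu> by (auto simp: bij_betw_def)
  from inv_into_into[OF this] show ?thesis
    by (simp add: mi_index_def)
qed

lemma index_eq_iff [simp]: "index q = index r \<longleftrightarrow> q = r"
  by (metis \<nu>_index)

lemma index_less_add:
  assumes "index q < index r"
  shows "index (q + s) < index (r + s)"
proof -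
  have "\<forall>i\<ge>1. \<forall>j\<ge>1. \<forall>k\<ge>1. i < j \<longrightarrow> index (\<nu> i + \<nu> k) < index (\<nu> j + \<nu> k)"
    using ordering by (simp add: graded_monomial_ordering_def)
  from this[rule_format, of "index q" "index r" "index s"] show ?thesis
    using assms index_ge_1 by simp
qed

lemma index_less_add_iff: "index (q + s) < index (r + s) \<longleftrightarrow> index q < index r"
proof (cases "index q" "index r" rule: linorder_cases)
  case less
  then show ?thesis using index_less_add by simp
next
  case equal
  then show ?thesis by simp
next
  case greater
  then show ?thesis using index_less_add[OF greater, of s] by simp
qed

lemma index_less_graded:
  assumes "mi_abs q < mi_abs r"
  shows "index q < index r"
proof -
  have "\<forall>i\<ge>1. \<forall>j\<ge>1. mi_abs (\<nu> i) < mi_abs (\<nu> j) \<longrightarrow> i < j"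
    using ordering by (simp add: graded_monomial_ordering_def)
  from this[rule_format, of "index q" "index r"] show ?thesis
    using assms index_ge_1 by simp
qed

text \<open>
  Because the ordering is graded, the indices of \<open>mi_upto p\<close> form an initial segment of the positive
  integers. This is what makes matrix columns and multi-indices interchangeable.
\<close>
lemma index_image_mi_upto: "index ` mi_upto p = {1..num_mi TYPE('d) p}"
proof -
  let ?A = "index ` mi_upto p"
  have fin: "finite ?A" using finite_mi_upto by blast
  have card: "card ?A = num_mi TYPE('d) p"
    unfolding num_mi_def by (intro card_image inj_onI) simp
  have "0 \<in> mi_upto p"
    by (simp add: mi_upto_def mi_abs_def)
  then have Max: "Max ?A \<in> ?A"
    using fin by (intro Max_in) auto
  have down: "i \<in> ?A" if ij: "1 \<le> i" "i \<le> j" "j \<in> ?A" for i j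
  proof -
    obtain q where q: "j = index q" "mi_abs q \<le> p"
      using ij by (auto simp: mi_upto_def)
    have "mi_abs (\<nu> i) \<le> mi_abs q"
      using index_less_graded[of q "\<nu> i"] ij q index_\<nu>[of i] by linarith
    then show ?thesis
      using that q index_\<nu>[of i] by (intro image_eqI[of _ _ "\<nu> i"]) (auto simp: mi_upto_def)
  qed
  have "?A = {1..Max ?A}"
  proof (intro equalityI subsetI)
    fix i assume "i \<in> {1..Max ?A}"
    then show "i \<in> ?A" using down[OF _ _ Max] by simp
  next
    fix i assume "i \<in> ?A"
    then show "i \<in> {1..Max ?A}" using Max_ge[OF fin] index_ge_1 by auto
  qed
  then obtain n where n: "?A = {1..n}" ..
  then show ?thesis using card by simp
qed

lemma index_in_iff: "index q \<in> {1..num_mi TYPE('d) p} \<longleftrightarrow> mi_abs q \<le> p"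
  unfolding index_image_mi_upto[symmetric] by (auto simp: mi_upto_def)

lemma sum_index: "(\<Sum>k\<in>{1..num_mi TYPE('d) p}. f k) = (\<Sum>q\<in>mi_upto p. f (index q))"
  unfolding index_image_mi_upto[symmetric] by (subst sum.reindex) (auto intro: inj_onI)

end

section \<open>Decompression as a recurrence\<close>

locale expansion = monomial_ordering \<nu> for \<nu> :: "nat \<Rightarrow> nat ^ 'd" +
  fixes a :: "nat ^ 'd \<Rightarrow> complex" and c p :: nat
  assumes order_c: "\<exists>m. mi_abs m = c \<and> a m \<noteq> 0" and c_le_p: "c \<le> p"
begin

text \<open>The analogue of the leading monomial of a polynomial; it is \<open>m*\<close> of the introduction.\<close>
definition lead :: "nat ^ 'd" where
  "lead = \<nu> (Max (index ` {m \<in> mi_upto c. a m \<noteq> 0}))"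

lemma lead_in: "lead \<in> mi_upto c" "a lead \<noteq> 0"
  and index_le_lead: "m \<in> mi_upto c \<Longrightarrow> a m \<noteq> 0 \<Longrightarrow> index m \<le> index lead"
proof -
  let ?A = "{m \<in> mi_upto c. a m \<noteq> 0}"
  have fin: "finite ?A"
    using finite_mi_upto[of c] by (rule rev_finite_subset) auto
  have "?A \<noteq> {}" using order_c by (auto simp: mi_upto_def)
  then have "Max (index ` ?A) \<in> index ` ?A"
    using fin by (intro Max_in) auto
  then obtain m where m: "m \<in> ?A" "Max (index ` ?A) = index m" by blast
  then show "lead \<in> mi_upto c" "a lead \<noteq> 0" by (auto simp: lead_def)
  show "index m \<le> index lead" if "m \<in> mi_upto c" "a m \<noteq> 0" for m
    using that m Max_ge[of "index ` ?A" "index m"] fin by (simp add: lead_def)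
qed

lemma mi_abs_lead: "mi_abs lead = c"
proof -
  obtain m where m: "mi_abs m = c" "a m \<noteq> 0" using order_c by blast
  then have "index m \<le> index lead" by (intro index_le_lead) (auto simp: mi_upto_def)
  then have "c \<le> mi_abs lead" using index_less_graded[of lead m] m by linarith
  then show ?thesis using lead_in by (simp add: mi_upto_def)
qed

lemma pde_matrix_nonzero_iff:
  "pde_matrix \<nu> a c i k \<noteq> 0 \<longleftrightarrow> (\<exists>m\<in>mi_upto c. a m \<noteq> 0 \<and> \<nu> k = \<nu> i + m)"
  unfolding pde_matrix_def
  by (auto simp: mi_add_diff_left mi_le_add intro!: bexI[of _ "\<nu> k - \<nu> i"] simp: mi_add_diff)

lemma rows_iff: "i \<in> pde_rows TYPE('d) c p \<longleftrightarrow> 1 \<le> i \<and> mi_abs (\<nu> i) + c \<le> p"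
  using index_in_iff[of "\<nu> i" "p - c"] index_\<nu>[of i] c_le_p
  unfolding pde_rows_def by (cases "1 \<le> i") auto

lemma index_add_le_lead:
  assumes "m \<in> mi_upto c" "a m \<noteq> 0"
  shows "index (n + m) \<le> index (n + lead)"
  using index_le_lead[OF assms] index_less_add_iff[of lead n m] by (simp add: add.commute not_less[symmetric])

lemma last_nonzero_eq:
  assumes "i \<in> pde_rows TYPE('d) c p"
  shows "last_nonzero \<nu> a c p i = index (\<nu> i + lead)"
  unfolding last_nonzero_def
proof (rule Max_eqI)
  show "finite {k \<in> pde_columns TYPE('d) p. pde_matrix \<nu> a c i k \<noteq> 0}"
    by (simp add: pde_columns_def)
  fix k assume k: "k \<in> {k \<in> pde_columns TYPE('d) p. pde_matrix \<nu> a c i k \<noteq> 0}"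
  then obtain m where m: "m \<in> mi_upto c" "a m \<noteq> 0" "\<nu> k = \<nu> i + m"
    using pde_matrix_nonzero_iff by blast
  have "k = index (\<nu> i + m)"
    using k m index_\<nu>[of k] by (simp add: pde_columns_def)
  then show "k \<le> index (\<nu> i + lead)"
    using index_add_le_lead m by simp
next
  have "index (\<nu> i + lead) \<in> pde_columns TYPE('d) p"
    using assms unfolding pde_columns_def index_in_iff by (simp add: rows_iff mi_abs_add mi_abs_lead)
  moreover have "pde_matrix \<nu> a c i (index (\<nu> i + lead)) \<noteq> 0"
    unfolding pde_matrix_nonzero_iff using lead_in by auto
  ultimately show
    "index (\<nu> i + lead) \<in> {k \<in> pde_columns TYPE('d) p. pde_matrix \<nu> a c i k \<noteq> 0}"
    by simp
qed

lemma dropped_eq: "dropped \<nu> a c p = index ` {q. mi_abs q \<le> p \<and> lead \<le> q}"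
proof -
  have "dropped \<nu> a c p = (\<lambda>i. index (\<nu> i + lead)) ` pde_rows TYPE('d) c p"
    unfolding dropped_def by (intro image_cong refl last_nonzero_eq)
  also have "\<dots> = index ` {q. mi_abs q \<le> p \<and> lead \<le> q}"
  proof (intro equalityI subsetI)
    fix k assume "k \<in> index ` {q. mi_abs q \<le> p \<and> lead \<le> q}"
    then obtain q where q: "k = index q" "mi_abs q \<le> p" "lead \<le> q" by blast
    have "mi_abs (q - lead) + c = mi_abs q"
      using arg_cong[OF mi_add_diff[OF q(3)], of mi_abs] by (simp add: mi_abs_add mi_abs_lead)
    then have "index (q - lead) \<in> pde_rows TYPE('d) c p"
      using q index_ge_1 by (simp add: rows_iff)
    then show "k \<in> (\<lambda>i. index (\<nu> i + lead)) ` pde_rows TYPE('d) c p"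
      using q mi_add_diff[OF q(3)]
      by (intro image_eqI[of _ _ "index (q - lead)"]) (auto simp: add.commute)
  qed (auto intro!: imageI simp: rows_iff mi_abs_add mi_abs_lead mi_le_add)
  finally show ?thesis .
qed

lemma stored_eq: "stored \<nu> a c p = index ` {q. mi_abs q \<le> p \<and> \<not> lead \<le> q}"
  unfolding stored_def dropped_eq pde_columns_def index_image_mi_upto[symmetric]
  by (auto simp: mi_upto_def)

text \<open>
  The columns are listed in the order of the rows whose last nonzero entries they carry. The matrix
  is then lower triangular: a nonzero entry right of the diagonal would lie beyond the last
  nonzero column of its row. All diagonal entries are \<open>a lead\<close>.
\<close>
lemma matrix_inverse_exists:
  "\<exists>B. matrix_inverse_on (pde_rows TYPE('d) c p) (dropped \<nu> a c p) (pde_matrix \<nu> a c) B"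
proof -
  let ?R = "pde_rows TYPE('d) c p" and ?h = "\<lambda>j. index (\<nu> j + lead)"
  define A where "A = (\<lambda>i j. pde_matrix \<nu> a c i (?h j))"
  have "A i j = 0" if "1 \<le> i" "i < j" for i j
  proof (rule ccontr)
    assume "A i j \<noteq> 0"
    then obtain m where m: "m \<in> mi_upto c" "a m \<noteq> 0" "\<nu> j + lead = \<nu> i + m"
      unfolding A_def pde_matrix_nonzero_iff by auto
    have "index (\<nu> i + lead) < index (\<nu> j + lead)"
      using that by (simp add: index_less_add_iff index_\<nu>)
    then show False
      using index_add_le_lead[OF m(1,2), of "\<nu> i"] m(3) by simp
  qed
  moreover have "A i i \<noteq> 0" for i
    unfolding A_def pde_matrix_nonzero_iff using lead_in by auto
  ultimately obtain B where B: "matrix_inverse_on ?R ?R A B"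
    using lower_triangular_inverse_exists[of A "num_mi TYPE('d) (p - c)"]
    unfolding pde_rows_def by blast
  have dropped: "dropped \<nu> a c p = ?h ` ?R"
    unfolding dropped_def by (intro image_cong refl last_nonzero_eq)
  have h_inverse: "index (\<nu> (?h j) - lead) = j" if "j \<in> ?R" for j
    using that mi_add_diff_left[of lead "\<nu> j"] by (simp add: add.commute rows_iff index_\<nu>)
  have inj: "inj_on ?h ?R"
    by (rule inj_on_inverseI[of _ "\<lambda>k. index (\<nu> k - lead)"]) (rule h_inverse)
  define B' where "B' = (\<lambda>k. B (index (\<nu> k - lead)))"
  have B': "B' (?h j) = B j" if "j \<in> ?R" for j
    unfolding B'_def h_inverse[OF that] ..
  have "(\<Sum>k\<in>?h ` ?R. pde_matrix \<nu> a c i k * B' k i') = (if i = i' then 1 else 0)"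
    if "i \<in> ?R" "i' \<in> ?R" for i i'
  proof -
    have "(\<Sum>k\<in>?h ` ?R. pde_matrix \<nu> a c i k * B' k i') = (\<Sum>j\<in>?R. A i j * B j i')"
      by (subst sum.reindex[OF inj]) (auto intro!: sum.cong simp: A_def B')
    then show ?thesis
      using B that unfolding matrix_inverse_on_def by simp
  qed
  moreover have "(\<Sum>i\<in>?R. B' (?h j) i * pde_matrix \<nu> a c i (?h j')) = (if ?h j = ?h j' then 1 else 0)"
    if "j \<in> ?R" "j' \<in> ?R" for j j'
  proof -
    have "?h j = ?h j' \<longleftrightarrow> j = j'"
      using inj that unfolding inj_on_def by blast
    moreover have "(\<Sum>i\<in>?R. B j i * A i j') = (if j = j' then 1 else 0)"
      using B that unfolding matrix_inverse_on_def by simp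
    ultimately show ?thesis
      unfolding B'[OF that(1)] A_def by presburger
  qed
  ultimately have "matrix_inverse_on ?R (dropped \<nu> a c p) (pde_matrix \<nu> a c) B'"
    unfolding matrix_inverse_on_def dropped by blast
  then show ?thesis by blast
qed

text \<open>The entries of \<open>M \<theta>\<close>, indexed by multi-indices instead of column numbers.\<close>
definition derivative :: "(nat \<Rightarrow> complex) \<Rightarrow> nat ^ 'd \<Rightarrow> complex" where
  "derivative \<theta> q = (\<Sum>k\<in>stored \<nu> a c p. decompression_matrix \<nu> a c p (index q) k * \<theta> k)"

lemma finite_stored: "finite (stored \<nu> a c p)"
  by (simp add: stored_def pde_columns_def)

lemma derivative_stored:
  assumes "index q \<in> stored \<nu> a c p"
  shows "derivative \<theta> q = \<theta> (index q)"
proof -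
  have "derivative \<theta> q = (\<Sum>k\<in>stored \<nu> a c p. if index q = k then \<theta> k else 0)"
    unfolding derivative_def decompression_matrix_def using assms by (intro sum.cong) auto
  then show ?thesis
    using assms finite_stored by simp
qed

text \<open>
  \<open>P M = 0\<close>: on the dropped columns the product of \<open>P\<close> with minus its inverse is minus the identity,
  which cancels the contribution of the stored columns.
\<close>
lemma pde_matrix_times_derivative:
  assumes "i \<in> pde_rows TYPE('d) c p"
  shows "(\<Sum>k\<in>pde_columns TYPE('d) p. pde_matrix \<nu> a c i k * derivative \<theta> (\<nu> k)) = 0"
proof -
  let ?P = "pde_matrix \<nu> a c" and ?B = "dropped_inverse \<nu> a c p"
  let ?R = "pde_rows TYPE('d) c p" and ?S = "stored \<nu> a c p" and ?D = "dropped \<nu> a c p"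
  let ?s = "\<lambda>i. \<Sum>k\<in>?S. ?P i k * \<theta> k"
  have "matrix_inverse_on ?R ?D ?P ?B"
    unfolding dropped_inverse_def using matrix_inverse_exists by (rule someI_ex)
  then have inverse: "(\<Sum>k\<in>?D. ?P i k * ?B k i') = (if i = i' then 1 else 0)" if "i' \<in> ?R" for i'
    using assms that unfolding matrix_inverse_on_def by blast
  have columns: "pde_columns TYPE('d) p = ?S \<union> ?D" "?S \<inter> ?D = {}"
    unfolding stored_eq dropped_eq pde_columns_def index_image_mi_upto[symmetric]
    by (auto simp: mi_upto_def)
  have index_\<nu>_col: "index (\<nu> k) = k" if "k \<in> ?S \<union> ?D" for k
    using that unfolding columns(1)[symmetric] by (simp add: pde_columns_def index_\<nu>)
  have fin: "finite ?S" "finite ?D"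
    using finite_stored by (simp_all add: dropped_def pde_rows_def)
  have dropped: "derivative \<theta> (\<nu> k) = - (\<Sum>i\<in>?R. ?B k i * ?s i)" if "k \<in> ?D" for k
  proof -
    have "k \<notin> ?S" using that columns(2) by blast
    then have "derivative \<theta> (\<nu> k) = - (\<Sum>l\<in>?S. \<Sum>i\<in>?R. ?B k i * (?P i l * \<theta> l))"
      using that unfolding derivative_def decompression_matrix_def
      by (simp add: index_\<nu>_col sum_distrib_right sum_negf mult.assoc)
    then show ?thesis
      unfolding sum_distrib_left by (subst sum.swap) simp
  qed
  have "(\<Sum>k\<in>?D. ?P i k * derivative \<theta> (\<nu> k)) = (\<Sum>k\<in>?D. \<Sum>i'\<in>?R. - (?P i k * ?B k i' * ?s i'))"
    by (intro sum.cong) (auto simp: dropped sum_distrib_left sum_negf mult.assoc)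
  also have "\<dots> = (\<Sum>i'\<in>?R. - (\<Sum>k\<in>?D. ?P i k * ?B k i') * ?s i')"
    by (subst sum.swap) (simp add: sum_negf sum_distrib_right)
  also have "\<dots> = (\<Sum>i'\<in>?R. if i = i' then - ?s i' else 0)"
    by (intro sum.cong) (auto simp: inverse)
  also have "\<dots> = - ?s i"
    using assms by (subst sum.delta') (auto simp: pde_rows_def)
  finally have "(\<Sum>k\<in>?D. ?P i k * derivative \<theta> (\<nu> k)) = - ?s i" .
  moreover have "(\<Sum>k\<in>?S. ?P i k * derivative \<theta> (\<nu> k)) = ?s i"
    by (intro sum.cong) (auto simp: derivative_stored index_\<nu>_col)
  ultimately show ?thesis
    unfolding columns(1) sum.union_disjoint[OF fin columns(2)] by simp
qed

text \<open>
  The row of \<open>n\<close> states that \<open>\<partial>\<^sup>n\<close> of the differential equation holds at the centre.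
\<close>
lemma pde_derivative:
  assumes "mi_abs n + c \<le> p"
  shows "(\<Sum>m\<in>mi_upto c. a m * derivative \<theta> (n + m)) = 0"
proof -
  have "(\<Sum>m\<in>mi_upto c. a m * derivative \<theta> (n + m)) =
    (\<Sum>q | q \<in> mi_upto p \<and> n \<le> q \<and> q - n \<in> mi_upto c. a (q - n) * derivative \<theta> q)"
    using assms
    by (intro sum.reindex_bij_witness[where i = "\<lambda>q. q - n" and j = "\<lambda>m. n + m"])
      (auto simp: mi_add_diff mi_add_diff_left mi_le_add mi_upto_def mi_abs_add)
  also have "\<dots> = (\<Sum>q\<in>mi_upto p. pde_matrix \<nu> a c (index n) (index q) * derivative \<theta> q)"
    using finite_mi_upto by (intro sum.mono_neutral_cong_left) (auto simp: pde_matrix_def)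
  also have "\<dots> = (\<Sum>k\<in>pde_columns TYPE('d) p. pde_matrix \<nu> a c (index n) k * derivative \<theta> (\<nu> k))"
    unfolding pde_columns_def sum_index by simp
  also have "\<dots> = 0"
    using assms index_ge_1 by (intro pde_matrix_times_derivative) (simp add: rows_iff)
  finally show ?thesis .
qed

lemma derivative_recurrence:
  assumes "mi_abs q \<le> p" "lead \<le> q"
  shows "derivative \<theta> q =
    - (\<Sum>m\<in>{m \<in> mi_upto c. a m \<noteq> 0} - {lead}. a m * derivative \<theta> (q - lead + m)) / a lead"
proof -
  let ?A = "{m \<in> mi_upto c. a m \<noteq> 0}" and ?n = "q - lead"
  have q: "?n + lead = q"
    using mi_add_diff[OF assms(2)] by (simp add: add.commute)
  then have "mi_abs ?n + c \<le> p"
    using assms(1) mi_abs_add[of ?n lead] by (simp add: mi_abs_lead)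
  then have "0 = (\<Sum>m\<in>mi_upto c. a m * derivative \<theta> (?n + m))"
    by (simp only: pde_derivative)
  also have "\<dots> = (\<Sum>m\<in>?A. a m * derivative \<theta> (?n + m))"
    using finite_mi_upto by (intro sum.mono_neutral_right) auto
  also have "\<dots> = a lead * derivative \<theta> q + (\<Sum>m\<in>?A - {lead}. a m * derivative \<theta> (?n + m))"
    using finite_mi_upto[of c] lead_in q by (subst sum.remove[of _ lead]) auto
  finally show ?thesis
    using lead_in by (simp add: field_simps eq_neg_iff_add_eq_0)
qed

text \<open>
  Evaluating the recurrence in the monomial ordering is legitimate because every \<open>m\<close> in it precedes
  \<open>lead\<close>, so that \<open>q - lead + m\<close> precedes \<open>q\<close>. The terms with \<open>a m = 0\<close> must be left out, since there
  \<open>m\<close> may come after \<open>lead\<close>.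
\<close>
lemma obtainable_derivatives:
  assumes one: "(\<lambda>e. 1) \<in> S" and a: "\<And>m. m \<in> mi_upto c \<Longrightarrow> (\<lambda>e. a m) \<in> S"
    and \<theta>: "\<And>k. k \<in> stored \<nu> a c p \<Longrightarrow> (\<lambda>e. \<theta> e k) \<in> S"
  shows "obtainable S (num_mi TYPE('d) p * (2 * card (mi_upto c :: (nat ^ 'd) set) + 4))
    ((\<lambda>q e. derivative (\<theta> e) q) ` mi_upto p)"
proof -
  let ?d = "\<lambda>q e. derivative (\<theta> e) q" and ?N = "num_mi TYPE('d) p"
  let ?M = "card (mi_upto c :: (nat ^ 'd) set)" and ?A = "{m \<in> mi_upto c. a m \<noteq> 0} - {lead}"
  \<comment> \<open>The ordering enumerates from \<open>1\<close>, sequences of operations from \<open>0\<close>.\<close>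
  let ?f = "\<lambda>k. ?d (\<nu> (Suc k))"
  have "obtainable (S \<union> ?f ` {..<k}) (2 * ?M + 4) {?f k}" if "k < ?N" for k
  proof -
    let ?T = "S \<union> ?f ` {..<k}"
    let ?q = "\<nu> (Suc k)"
    have index_q: "index ?q = Suc k" by (simp add: index_\<nu>)
    then have q: "mi_abs ?q \<le> p"
      using that index_in_iff[of ?q p] by simp
    show ?thesis
    proof (cases "lead \<le> ?q")
      case False
      then have stored: "index ?q \<in> stored \<nu> a c p"
        unfolding stored_eq using q by blast
      then have "?f k = (\<lambda>e. \<theta> e (index ?q))"
        by (simp add: derivative_stored)
      then have "{?f k} \<subseteq> ?T"
        using \<theta>[OF stored] by simp
      from obtainable_subset[OF this] show ?thesis
        by (rule obtainable_mono) auto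
    next
      case True
      let ?s = "\<lambda>e. \<Sum>m\<in>?A. a m * ?d (?q - lead + m) e"
      have fin: "finite ?A"
        using finite_mi_upto[of c] by (rule rev_finite_subset) auto
      have "card ?A \<le> ?M"
        using finite_mi_upto[of c] by (intro card_mono) auto
      have prev: "?d (?q - lead + m) \<in> ?T" if m: "m \<in> ?A" for m
      proof -
        let ?r = "?q - lead + m"
        have "index m < index lead"
          using index_le_lead[of m] m by (intro le_neq_implies_less) auto
        then have "index ?r < index (?q - lead + lead)"
          using index_less_add[of m lead "?q - lead"] by (simp add: add.commute)
        then have "index ?r < Suc k"
          using mi_add_diff[OF True] index_q by (simp add: add.commute)
        then have "index ?r - 1 < k" "Suc (index ?r - 1) = index ?r"
          using index_ge_1[of ?r] by auto
        then have "?d ?r = ?f (index ?r - 1)" "index ?r - 1 \<in> {..<k}" by simp_all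
        then show ?thesis by blast
      qed
      have "obtainable ?T (2 * card ?A + 1) {?s}"
        using fin prev a one by (intro obtainable_sum_mult) auto
      moreover have "obtainable (?T \<union> {?s}) (1 + 1 + 1) {\<lambda>e. - ?s e / a lead}"
        using one a lead_in
        by (intro obtainable_trans[OF obtainable_uminus[of _ ?s]] obtainable_divide) auto
      ultimately have "obtainable ?T (2 * card ?A + 1 + (1 + 1 + 1)) {\<lambda>e. - ?s e / a lead}"
        by (rule obtainable_trans)
      moreover have "(\<lambda>e. - ?s e / a lead) = ?f k"
        by (rule ext) (rule derivative_recurrence[OF q True, symmetric])
      ultimately show ?thesis
        using \<open>card ?A \<le> ?M\<close> by (elim obtainable_mono) auto
    qed
  qed
  then have "obtainable S (?N * (2 * ?M + 4)) (?f ` {..<?N})"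
    by (intro obtainable_sequence)
  moreover have "?d ` mi_upto p \<subseteq> ?f ` {..<?N}"
  proof
    fix g assume "g \<in> ?d ` mi_upto p"
    then obtain q where q: "g = ?d q" "mi_abs q \<le> p" by (auto simp: mi_upto_def)
    then have "index q - 1 < ?N" "Suc (index q - 1) = index q"
      using index_in_iff[of q p] index_ge_1[of q] by auto
    then have "g = ?f (index q - 1)" "index q - 1 \<in> {..<?N}" using q by simp_all
    then show "g \<in> ?f ` {..<?N}" by blast
  qed
  ultimately show ?thesis
    by (elim obtainable_mono) auto
qed

section \<open>The translation program\<close>

lemma translated_coeff_eq:
  "translated_coeff \<nu> a c p c1 c2 \<theta> (index i) =
     translate_along p (derivative \<theta>) (translation_kernel (c2 - c1)) UNIV i / (\<Prod>k\<in>UNIV. fact (i $ k))"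
proof -
  let ?t = "\<lambda>q. taylor_coeff \<nu> a c p \<theta> (index q) * of_nat (mi_binomial q i) *
    of_real (mi_power (c2 - c1) (q - i))"
  have "translated_coeff \<nu> a c p c1 c2 \<theta> (index i) =
    (\<Sum>q | mi_abs q \<le> p \<and> i \<le> q. ?t q)"
    unfolding translated_coeff_def
  proof (rule sum.reindex_bij_witness[where i = index and j = \<nu>])
    fix k assume "k \<in> {k \<in> {1..num_mi TYPE('d) p}. \<nu> (index i) \<le> \<nu> k}"
    then have k: "1 \<le> k" "index (\<nu> k) \<in> {1..num_mi TYPE('d) p}" "i \<le> \<nu> k"
      by (auto simp: index_\<nu>)
    then show "index (\<nu> k) = k" by (simp add: index_\<nu>)
    show "\<nu> k \<in> {q. mi_abs q \<le> p \<and> i \<le> q}"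
      using k unfolding index_in_iff by simp
    show "?t (\<nu> k) = taylor_coeff \<nu> a c p \<theta> k * of_nat (mi_binomial (\<nu> k) (\<nu> (index i))) *
      of_real (mi_power (c2 - c1) (\<nu> k - \<nu> (index i)))"
      using k by (simp add: index_\<nu>)
  next
    fix q assume "q \<in> {q. mi_abs q \<le> p \<and> i \<le> q}"
    then show "index q \<in> {k \<in> {1..num_mi TYPE('d) p}. \<nu> (index i) \<le> \<nu> k}"
      using index_in_iff[of q p] by simp
  qed simp
  also have "\<dots> = (\<Sum>q | mi_abs q \<le> p \<and> i \<le> q.
      (derivative \<theta> q * (\<Prod>k\<in>UNIV. translation_kernel (c2 - c1) k (q $ k - i $ k)))
        / (\<Prod>k\<in>UNIV. fact (i $ k)))"
    by (intro sum.cong refl)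
      (simp only: mem_Collect_eq taylor_coeff_def derivative_def[symmetric] \<nu>_index
        taylor_shift_term_eq)
  finally show ?thesis
    unfolding translate_along_def by (simp add: sum_divide_distrib)
qed

lemma stored_hyperplanes:
  "{q. mi_abs q \<le> p \<and> \<not> lead \<le> q} =
     (\<Union>(k, r)\<in>Sigma UNIV (\<lambda>k. {..<lead $ k}). {q. mi_abs q \<le> p \<and> q $ k = r})"
  by (auto simp: less_eq_vec_def not_le)

text \<open>
  The stages are: the derivatives at \<open>c1\<close>, the one-dimensional kernels, the convolution on each of
  the \<open>c\<close> hyperplanes, the factorials, and the division by \<open>i!\<close>. The kernels and the
  factorials take \<open>O(p)\<close> operations, which the bound covers even for \<open>d = 1\<close>.
\<close>
lemma obtainable_translation:
  fixes c1 c2 :: "'e \<Rightarrow> real ^ 'd" and \<theta> :: "'e \<Rightarrow> nat \<Rightarrow> complex"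
  assumes one: "(\<lambda>e. 1) \<in> S" and a: "\<And>m. m \<in> mi_upto c \<Longrightarrow> (\<lambda>e. a m) \<in> S"
    and \<theta>: "\<And>k. k \<in> stored \<nu> a c p \<Longrightarrow> (\<lambda>e. \<theta> e k) \<in> S"
    and c1: "\<And>k. (\<lambda>e. of_real (c1 e $ k)) \<in> S" and c2: "\<And>k. (\<lambda>e. of_real (c2 e $ k)) \<in> S"
  shows "obtainable S
    ((2 * card (mi_upto c :: (nat ^ 'd) set) + 5 * CARD('d) + 3 * c * CARD('d) + 7)
       * (p + 1) ^ CARD('d))
    ((\<lambda>i e. translated_coeff \<nu> a c p (c1 e) (c2 e) (\<theta> e) i) ` stored \<nu> a c p)"
proof -
  let ?d = "CARD('d)" and ?M = "card (mi_upto c :: (nat ^ 'd) set)"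
  let ?D = "(\<lambda>q e. derivative (\<theta> e) q) ` mi_upto p"
  let ?w = "\<lambda>e. translation_kernel (c2 e - c1 e)"
  let ?W = "\<Union>k. (\<lambda>n e. ?w e k n) ` {..<p + 1}"
  let ?T = "\<lambda>i e. translate_along p (derivative (\<theta> e)) (?w e) UNIV i"
  let ?Q = "{q. mi_abs q \<le> p \<and> \<not> lead \<le> q}"
  let ?F = "(\<lambda>m e. fact m) ` {..<p + 1} :: ('e \<Rightarrow> complex) set"
  have "?d \<ge> 1" by simp
  then have power_d: "(p + 1) ^ ?d = (p + 1) ^ (?d - 1) * (p + 1)"
    by (metis One_nat_def Suc_pred less_eq_Suc_le power_Suc2)
  have p1: "p + 1 \<le> (p + 1) ^ ?d"
    using \<open>?d \<ge> 1\<close> by (simp add: self_le_power)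
  have D: "obtainable S ((2 * ?M + 4) * (p + 1) ^ ?d) ?D"
  proof (rule obtainable_mono)
    show "obtainable S (num_mi TYPE('d) p * (2 * ?M + 4)) ?D"
      using one a \<theta> by (rule obtainable_derivatives)
    show "num_mi TYPE('d) p * (2 * ?M + 4) \<le> (2 * ?M + 4) * (p + 1) ^ ?d"
      unfolding mult.commute[of "num_mi TYPE('d) p"] by (intro mult_left_mono num_mi_le) simp
  qed simp_all
  have W: "obtainable S (4 * ?d * (p + 1) ^ ?d) ?W"
  proof -
    have "obtainable S (1 + 3 * (p + 1)) ((\<lambda>n e. ?w e k n) ` {..<p + 1})" for k
    proof -
      let ?h = "\<lambda>e. of_real (c2 e $ k) - of_real (c1 e $ k) :: complex"
      have "obtainable S (1 + 3 * (p + 1)) ((\<lambda>n e. ?h e ^ n / fact n) ` {..<p + 1})"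
        using one c1 c2
        by (intro obtainable_trans[OF obtainable_diff[of "\<lambda>e. of_real (c2 e $ k)" S
                "\<lambda>e. of_real (c1 e $ k)"]] obtainable_power_over_fact) auto
      then show ?thesis by (simp add: translation_kernel_def)
    qed
    then have "obtainable S (?d * (1 + 3 * (p + 1))) ?W"
      by (intro obtainable_UN) auto
    moreover have "?d * (1 + 3 * (p + 1)) \<le> ?d * (4 * (p + 1) ^ ?d)"
      using p1 by (intro mult_left_mono) auto
    ultimately show ?thesis
      by (elim obtainable_mono) (auto simp: mult_ac)
  qed
  have T: "obtainable (S \<union> ?D \<union> ?W) (3 * c * ?d * (p + 1) ^ ?d) (?T ` ?Q)"
  proof -
    let ?I = "Sigma UNIV (\<lambda>k. {..<lead $ k})"
    have "obtainable (S \<union> ?D \<union> ?W) (card ?I * (?d * ((p + 1) ^ (?d - 1) * (2 * p + 3))))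
      (\<Union>x\<in>?I. ?T ` {q. mi_abs q \<le> p \<and> q $ fst x = snd x})"
    proof (intro obtainable_UN obtainable_translate_hyperplane)
      show "(\<lambda>e. ?w e k n) \<in> S \<union> ?D \<union> ?W" if "n \<le> p" for k n
        using that by (intro UnI2 UN_I[of k] image_eqI[of _ _ n]) auto
    qed (use one in \<open>auto simp: mi_upto_def\<close>)
    \<comment> \<open>There are \<open>lead\<^sub>k\<close> hyperplanes orthogonal to direction \<open>k\<close>, in total \<open>|lead| = c\<close>.\<close>
    moreover have "card ?I = c"
      using mi_abs_lead by (simp add: mi_abs_def)
    moreover have "(p + 1) ^ (?d - 1) * (2 * p + 3) \<le> 3 * (p + 1) ^ ?d"
      unfolding power_d by (simp add: algebra_simps)
    then have "c * (?d * ((p + 1) ^ (?d - 1) * (2 * p + 3))) \<le> c * (?d * (3 * (p + 1) ^ ?d))"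
      by (intro mult_left_mono) auto
    ultimately show ?thesis
      unfolding stored_hyperplanes by (elim obtainable_mono) (auto simp: mult_ac)
  qed
  have F: "obtainable S (2 * (p + 1) ^ ?d) ?F"
    using obtainable_fact[OF one, of "p + 1"] p1 by (elim obtainable_mono) auto
  let ?U = "S \<union> ?D \<union> ?W \<union> ?T ` ?Q \<union> ?F"
  have out: "obtainable ?U ((?d + 1) * (p + 1) ^ ?d)
    ((\<lambda>i e. translated_coeff \<nu> a c p (c1 e) (c2 e) (\<theta> e) i) ` stored \<nu> a c p)"
  proof -
    have "obtainable ?U (?d + 1) {\<lambda>e. translated_coeff \<nu> a c p (c1 e) (c2 e) (\<theta> e) i}"
      if "i \<in> stored \<nu> a c p" for i
    proof -
      obtain q where q: "i = index q" "q \<in> ?Q"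
        using \<open>i \<in> stored \<nu> a c p\<close> unfolding stored_eq by blast
      let ?g = "\<lambda>e :: 'e. \<Prod>k\<in>UNIV. fact (q $ k) :: complex"
      have "(\<lambda>e. fact (q $ k)) \<in> ?U" for k
        using q(2) mi_abs_component_le[of q k] by (intro UnI2 image_eqI[of _ _ "q $ k"]) auto
      then have "obtainable ?U ?d {?g}"
        using one by (intro obtainable_prod) auto
      moreover have "obtainable (?U \<union> {?g}) 1 {\<lambda>e. ?T q e / ?g e}"
        using q(2) by (intro obtainable_divide) auto
      ultimately show ?thesis
        unfolding q(1) translated_coeff_eq by (rule obtainable_trans)
    qed
    then have "obtainable ?U (card (stored \<nu> a c p) * (?d + 1))
        ((\<lambda>i e. translated_coeff \<nu> a c p (c1 e) (c2 e) (\<theta> e) i) ` stored \<nu> a c p)"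
      by (intro obtainable_image finite_stored)
    moreover have "card (stored \<nu> a c p) \<le> card {1..num_mi TYPE('d) p}"
      unfolding stored_def pde_columns_def by (intro card_mono) auto
    then have "card (stored \<nu> a c p) \<le> (p + 1) ^ ?d"
      using num_mi_le[where 'd = 'd, of p] by simp
    then have "card (stored \<nu> a c p) * (?d + 1) \<le> (?d + 1) * (p + 1) ^ ?d"
      unfolding mult.commute[of "card _"] by (intro mult_left_mono) auto
    ultimately show ?thesis
      by (elim obtainable_mono) auto
  qed
  have W': "obtainable (S \<union> ?D) (4 * ?d * (p + 1) ^ ?d) ?W"
    using W by (rule obtainable_mono) auto
  have F': "obtainable (S \<union> ?D \<union> ?W \<union> ?T ` ?Q) (2 * (p + 1) ^ ?d) ?F"
    using F by (rule obtainable_mono) auto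
  have "obtainable S ((2 * ?M + 4) * (p + 1) ^ ?d + (4 * ?d * (p + 1) ^ ?d +
      (3 * c * ?d * (p + 1) ^ ?d + (2 * (p + 1) ^ ?d + (?d + 1) * (p + 1) ^ ?d))))
    ((\<lambda>i e. translated_coeff \<nu> a c p (c1 e) (c2 e) (\<theta> e) i) ` stored \<nu> a c p)"
    by (rule obtainable_trans[OF D obtainable_trans[OF W' obtainable_trans[OF T
            obtainable_trans[OF F' out]]]])
  then show ?thesis
    by (rule obtainable_mono) (simp_all add: algebra_simps)
qed

lemma translation_program_exists:
  "\<exists>\<pi> :: 'd translation_input program. solves_translation \<nu> a c p \<pi> \<and> work \<pi> \<le>
     (2 * card (mi_upto c :: (nat ^ 'd) set) + 5 * CARD('d) + 3 * c * CARD('d) + 7)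
       * (p + 1) ^ CARD('d)"
proof -
  define env where "env = (\<lambda>(c1, c2, \<theta>). translation_env \<nu> a c p c1 c2 \<theta>)"
  have input: "f \<in> given env" if "\<And>e. env e v = Some (f e)" for f v
    using that unfolding given_def by blast
  have "\<exists>\<pi> :: 'd translation_input program. work \<pi> \<le>
     (2 * card (mi_upto c :: (nat ^ 'd) set) + 5 * CARD('d) + 3 * c * CARD('d) + 7)
       * (p + 1) ^ CARD('d) \<and> (\<forall>e. computes \<pi> (env e) (stored \<nu> a c p)
         (\<lambda>i. translated_coeff \<nu> a c p (fst e) (fst (snd e)) (snd (snd e)) i))"
  proof (intro obtainable_imp_program obtainable_translation)
    show "(\<lambda>e. 1) \<in> given env" by (simp add: given_def)
    show "(\<lambda>e. a m) \<in> given env" if "m \<in> mi_upto c" for m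
      using that by (intro input[of "Coeff m"]) (auto simp: env_def)
    show "(\<lambda>e. snd (snd e) k) \<in> given env" if "k \<in> stored \<nu> a c p" for k
      using that by (intro input[of "Theta k"]) (auto simp: env_def)
    show "(\<lambda>e. of_real (fst e $ k)) \<in> given env" for k
      by (intro input[of "Center1 k"]) (auto simp: env_def)
    show "(\<lambda>e. of_real (fst (snd e) $ k)) \<in> given env" for k
      by (intro input[of "Center2 k"]) (auto simp: env_def)
  qed
  then obtain \<pi> :: "'d translation_input program" where \<pi>: "work \<pi> \<le>
     (2 * card (mi_upto c :: (nat ^ 'd) set) + 5 * CARD('d) + 3 * c * CARD('d) + 7)
       * (p + 1) ^ CARD('d)"
    "\<And>e. computes \<pi> (env e) (stored \<nu> a c p)
         (\<lambda>i. translated_coeff \<nu> a c p (fst e) (fst (snd e)) (snd (snd e)) i)"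
    by blast
  have "solves_translation \<nu> a c p \<pi>"
    unfolding solves_translation_def
  proof (intro allI)
    fix c1 c2 \<theta>
    show "computes \<pi> (translation_env \<nu> a c p c1 c2 \<theta>) (stored \<nu> a c p)
      (translated_coeff \<nu> a c p c1 c2 \<theta>)"
      using \<pi>(2)[of "(c1, c2, \<theta>)"] by (simp add: env_def)
  qed
  with \<pi>(1) show ?thesis by blast
qed

end

theorem theorem15:
  fixes \<nu> :: "nat \<Rightarrow> nat ^ 'd" and a :: "nat ^ 'd \<Rightarrow> complex" and c :: nat
  assumes "graded_monomial_ordering \<nu>"
    and "c \<ge> 1"
    and "\<exists>m. mi_abs m = c \<and> a m \<noteq> 0"
  shows "\<exists>\<pi> :: nat \<Rightarrow> 'd translation_input program.
           (\<forall>p\<ge>c. solves_translation \<nu> a c p (\<pi> p)) \<and>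
           (\<lambda>p. real (work (\<pi> p))) \<in> O(\<lambda>p. real p ^ CARD('d))"
proof -
  define C where "C = 2 * card (mi_upto c :: (nat ^ 'd) set) + 5 * CARD('d) + 3 * c * CARD('d) + 7"
  have "\<exists>\<pi> :: 'd translation_input program.
    p \<ge> c \<longrightarrow> solves_translation \<nu> a c p \<pi> \<and> work \<pi> \<le> C * (p + 1) ^ CARD('d)" for p
  proof (cases "c \<le> p")
    case True
    then interpret expansion \<nu> a c p
      using assms by unfold_locales
    show ?thesis using translation_program_exists unfolding C_def by blast
  qed simp
  then obtain \<pi> :: "nat \<Rightarrow> 'd translation_input program" where \<pi>:
    "\<And>p. p \<ge> c \<Longrightarrow> solves_translation \<nu> a c p (\<pi> p)"
    "\<And>p. p \<ge> c \<Longrightarrow> work (\<pi> p) \<le> C * (p + 1) ^ CARD('d)"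
    by metis
  have "(\<lambda>p. real (work (\<pi> p))) \<in> O(\<lambda>p. real p ^ CARD('d))"
  proof (rule bigoI[where c = "real C * 2 ^ CARD('d)"])
    show "\<forall>\<^sub>F p in at_top. norm (real (work (\<pi> p))) \<le>
      real C * 2 ^ CARD('d) * norm (real p ^ CARD('d))"
      using eventually_ge_at_top[of c]
    proof eventually_elim
      case (elim p)
      have "work (\<pi> p) \<le> C * (p + 1) ^ CARD('d)"
        using \<pi>(2) elim .
      \<comment> \<open>\<open>p + 1 \<le> 2 p\<close> since \<open>p \<ge> c \<ge> 1\<close>\<close>
      also have "\<dots> \<le> C * (2 * p) ^ CARD('d)"
        using elim assms(2) by (intro mult_left_mono power_mono) auto
      finally have "real (work (\<pi> p)) \<le> real (C * (2 * p) ^ CARD('d))"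
        by (simp only: of_nat_le_iff)
      then show ?case
        by (simp add: power_mult_distrib mult.assoc)
    qed
  qed
  then show ?thesis
    using \<pi>(1) by blast
qed

end
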